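(* Let $f:(M,h)\to(N,g)$ be a holomorphic map between two Hermitian manifolds, with $M$ compact. Suppose that one of the following holds: (i) $(M,h)$ has positive holomorphic sectional curvature and $(N,g)$ has non-positive holomorphic sectional curvature; or (ii) $(M,h)$ has non-negative holomorphic sectional curvature and $(N,g)$ has negative holomorphic sectional curvature. Then $f$ is a constant map.
   Context: Manifolds are connected. For a Hermitian manifold $(X,g)$, $R_{i\bar jk\bar\ell}=-\frac{\partial^2g_{k\bar\ell}}{\partial z^i\partial\bar z^j}+g^{p\bar q}\frac{\partial g_{k\bar q}}{\partial z^i}\frac{\partial g_{p\bar\ell}}{\partial\bar z^j}$ is the curvature of the Chern connection of $(T^{1,0}X,g)$. The holomorphic sectional curvature is positive (resp. non-negative, non-positive, negative) if at each point $R_{i\bar jk\bar\ell}v^i\bar v^jv^k\bar v^\ell>0$ (resp. $\ge0$, $\le0$, $<0$) for all nonzero $v=v^i\partial/\partial z^i\in T^{1,0}X$. *)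

theory Defs
  imports "HOL-Analysis.Analysis"
begin

section \<open>Differentiability in several variables\<close>

text \<open>Both notions are meant for open \<open>S\<close>; the derivatives are taken with respect to the full
  neighbourhood filter.\<close>

definition holo_on :: "(complex^'m \<Rightarrow> complex^'n) \<Rightarrow> (complex^'m) set \<Rightarrow> bool" where
  "holo_on f S \<longleftrightarrow>
     (\<forall>z\<in>S. \<exists>D. (f has_derivative D) (at z) \<and> (\<forall>c v. D (c *s v) = c *s D v))"

primrec Ck_on :: "nat \<Rightarrow> ('a::real_normed_vector \<Rightarrow> 'b::real_normed_vector) \<Rightarrow> 'a set \<Rightarrow> bool" where
  "Ck_on 0 f S \<longleftrightarrow> continuous_on S f"
| "Ck_on (Suc k) f S \<longleftrightarrow> (\<forall>x\<in>S. f differentiable (at x)) \<and>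
     (\<forall>v. Ck_on k (\<lambda>x. frechet_derivative f (at x) v) S)"

definition smooth_on :: "('a::real_normed_vector \<Rightarrow> 'b::real_normed_vector) \<Rightarrow> 'a set \<Rightarrow> bool" where
  "smooth_on f S \<longleftrightarrow> (\<forall>k. Ck_on k f S)"

text \<open>The Wirtinger operators \<open>\<partial>/\<partial>z\<^sup>i = (\<partial>/\<partial>x\<^sup>i - \<i> \<partial>/\<partial>y\<^sup>i)/2\<close> and
  \<open>\<partial>/\<partial>\<bar>z\<^sup>i = (\<partial>/\<partial>x\<^sup>i + \<i> \<partial>/\<partial>y\<^sup>i)/2\<close>, where \<open>z\<^sup>i = x\<^sup>i + \<i> y\<^sup>i\<close>.\<close>

definition dz :: "'n::finite \<Rightarrow> (complex^'n \<Rightarrow> complex) \<Rightarrow> complex^'n \<Rightarrow> complex" where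
  "dz i F z = (frechet_derivative F (at z) (axis i 1)
               - \<i> * frechet_derivative F (at z) (axis i \<i>)) / 2"

definition dzbar :: "'n::finite \<Rightarrow> (complex^'n \<Rightarrow> complex) \<Rightarrow> complex^'n \<Rightarrow> complex" where
  "dzbar i F z = (frechet_derivative F (at z) (axis i 1)
                  + \<i> * frechet_derivative F (at z) (axis i \<i>)) / 2"

section \<open>Complex manifolds\<close>

text \<open>A chart is a pair of a domain and a coordinate map; the values of the coordinate map outside
  the domain are irrelevant.\<close>

type_synonym ('a, 'n) chart = "'a set \<times> ('a \<Rightarrow> complex^'n)"

definition chart_inv :: "('a, 'n) chart \<Rightarrow> complex^'n \<Rightarrow> 'a" where
  "chart_inv \<alpha> = inv_into (fst \<alpha>) (snd \<alpha>)"

definition transition :: "('a, 'n) chart \<Rightarrow> ('a, 'n) chart \<Rightarrow> complex^'n \<Rightarrow> complex^'n" where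
  "transition \<alpha> \<beta> = snd \<beta> \<circ> chart_inv \<alpha>"

definition complex_manifold :: "'a topology \<Rightarrow> ('a, 'n::finite) chart set \<Rightarrow> bool" where
  "complex_manifold X A \<longleftrightarrow>
     Hausdorff_space X \<and> second_countable X \<and> connected_space X \<and>
     (\<Union>\<alpha>\<in>A. fst \<alpha>) = topspace X \<and>
     (\<forall>\<alpha>\<in>A. openin X (fst \<alpha>) \<and> open (snd \<alpha> ` fst \<alpha>) \<and>
        homeomorphic_map (subtopology X (fst \<alpha>)) (top_of_set (snd \<alpha> ` fst \<alpha>)) (snd \<alpha>)) \<and>
     (\<forall>\<alpha>\<in>A. \<forall>\<beta>\<in>A. holo_on (transition \<alpha> \<beta>) (snd \<alpha> ` (fst \<alpha> \<inter> fst \<beta>)))"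

definition holomorphic_map ::
  "'a topology \<Rightarrow> ('a, 'm::finite) chart set \<Rightarrow> 'b topology \<Rightarrow> ('b, 'n::finite) chart set
     \<Rightarrow> ('a \<Rightarrow> 'b) \<Rightarrow> bool" where
  "holomorphic_map X A Y B f \<longleftrightarrow>
     continuous_map X Y f \<and>
     (\<forall>\<alpha>\<in>A. \<forall>\<beta>\<in>B. holo_on (snd \<beta> \<circ> f \<circ> chart_inv \<alpha>) (snd \<alpha> ` (fst \<alpha> \<inter> f -` fst \<beta>)))"

section \<open>The holomorphic tangent bundle\<close>

text \<open>A vector in \<open>T\<^sup>1\<^sup>,\<^sup>0\<close> at \<open>p\<close> is a family of coordinate vectors, one for each chart around \<open>p\<close>,
  that transforms by the complex Jacobians of the transition maps: if \<open>v = v\<^sup>i \<partial>/\<partial>z\<^sup>i\<close> in the chart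
  \<open>\<alpha>\<close>, then \<open>v\<^sup>i = v \<alpha> $ i\<close>. The family is set to \<open>0\<close> at all other charts, so that equality of
  tangent vectors is equality of functions.\<close>

type_synonym ('a, 'n) tvec = "('a, 'n) chart \<Rightarrow> complex^'n"

definition tangent_space :: "('a, 'n::finite) chart set \<Rightarrow> 'a \<Rightarrow> ('a, 'n) tvec set" where
  "tangent_space A p = {v.
     (\<forall>\<alpha>. \<not> (\<alpha> \<in> A \<and> p \<in> fst \<alpha>) \<longrightarrow> v \<alpha> = 0) \<and>
     (\<forall>\<alpha>\<in>A. \<forall>\<beta>\<in>A. p \<in> fst \<alpha> \<and> p \<in> fst \<beta> \<longrightarrow>
        v \<beta> = frechet_derivative (transition \<alpha> \<beta>) (at (snd \<alpha> p)) (v \<alpha>))}"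

text \<open>The coordinate vector \<open>\<partial>/\<partial>z\<^sup>i\<close> of the chart \<open>\<alpha>\<close> at \<open>p\<close>.\<close>

definition coord_vec :: "('a, 'n::finite) chart set \<Rightarrow> ('a, 'n) chart \<Rightarrow> 'a \<Rightarrow> 'n \<Rightarrow> ('a, 'n) tvec" where
  "coord_vec A \<alpha> p i = (\<lambda>\<beta>. if \<beta> \<in> A \<and> p \<in> fst \<beta>
     then frechet_derivative (transition \<alpha> \<beta>) (at (snd \<alpha> p)) (axis i 1) else 0)"

section \<open>Hermitian metrics and their Chern curvature\<close>

text \<open>A metric assigns to each point \<open>p\<close> a form on the tangent space at \<open>p\<close>, linear in the first
  and conjugate-linear in the second argument.\<close>

type_synonym ('a, 'n) metric = "'a \<Rightarrow> ('a, 'n) tvec \<Rightarrow> ('a, 'n) tvec \<Rightarrow> complex"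

text \<open>\<open>g\<^bsub>k\<bar>l\<^esub>\<close> as a function of the coordinates of the chart \<open>\<alpha>\<close>.\<close>

definition metric_coeff ::
  "('a, 'n::finite) chart set \<Rightarrow> ('a, 'n) metric \<Rightarrow> ('a, 'n) chart \<Rightarrow> 'n \<Rightarrow> 'n \<Rightarrow> complex^'n \<Rightarrow> complex"
  where
  "metric_coeff A g \<alpha> k l z =
     (let p = chart_inv \<alpha> z in g p (coord_vec A \<alpha> p k) (coord_vec A \<alpha> p l))"

definition hermitian_metric :: "'a topology \<Rightarrow> ('a, 'n::finite) chart set \<Rightarrow> ('a, 'n) metric \<Rightarrow> bool"
  where
  "hermitian_metric X A g \<longleftrightarrow>
     (\<forall>p\<in>topspace X.
        (\<forall>u\<in>tangent_space A p. \<forall>v\<in>tangent_space A p. \<forall>w\<in>tangent_space A p.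
           g p (\<lambda>\<alpha>. u \<alpha> + v \<alpha>) w = g p u w + g p v w) \<and>
        (\<forall>c. \<forall>u\<in>tangent_space A p. \<forall>w\<in>tangent_space A p.
           g p (\<lambda>\<alpha>. c *s u \<alpha>) w = c * g p u w) \<and>
        (\<forall>u\<in>tangent_space A p. \<forall>w\<in>tangent_space A p. g p w u = cnj (g p u w)) \<and>
        (\<forall>u\<in>tangent_space A p. u \<noteq> (\<lambda>\<alpha>. 0) \<longrightarrow> Re (g p u u) > 0)) \<and>
     (\<forall>\<alpha>\<in>A. \<forall>k l. smooth_on (metric_coeff A g \<alpha> k l) (snd \<alpha> ` fst \<alpha>))"

definition hermitian_manifold :: "'a topology \<Rightarrow> ('a, 'n::finite) chart set \<Rightarrow> ('a, 'n) metric \<Rightarrow> bool"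
  where
  "hermitian_manifold X A g \<longleftrightarrow> complex_manifold X A \<and> hermitian_metric X A g"

text \<open>The inverse \<open>g\<^sup>p\<^sup>\<bar>\<^sup>q\<close> is normalised by \<open>\<Sum>q. g\<^sup>p\<^sup>\<bar>\<^sup>q g\<^bsub>r\<bar>q\<^esub> = \<delta>\<^bsub>pr\<^esub>\<close>. It is therefore the transpose of
  the matrix inverse of \<open>(g\<^bsub>p\<bar>q\<^esub>)\<close> with row index \<open>p\<close> and column index \<open>q\<close>.\<close>

definition metric_inv_coeff ::
  "('a, 'n::finite) chart set \<Rightarrow> ('a, 'n) metric \<Rightarrow> ('a, 'n) chart \<Rightarrow> 'n \<Rightarrow> 'n \<Rightarrow> complex^'n \<Rightarrow> complex"
  where
  "metric_inv_coeff A g \<alpha> p q z = matrix_inv (\<chi> r s. metric_coeff A g \<alpha> r s z) $ q $ p"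

definition chern_curvature ::
  "('a, 'n::finite) chart set \<Rightarrow> ('a, 'n) metric \<Rightarrow> ('a, 'n) chart
     \<Rightarrow> 'n \<Rightarrow> 'n \<Rightarrow> 'n \<Rightarrow> 'n \<Rightarrow> complex^'n \<Rightarrow> complex" where
  "chern_curvature A g \<alpha> i j k l z =
     - dz i (dzbar j (metric_coeff A g \<alpha> k l)) z
     + (\<Sum>p\<in>UNIV. \<Sum>q\<in>UNIV. metric_inv_coeff A g \<alpha> p q z
          * dz i (metric_coeff A g \<alpha> k q) z * dzbar j (metric_coeff A g \<alpha> p l) z)"

text \<open>\<open>R\<^bsub>i\<bar>jk\<bar>l\<^esub> v\<^sup>i \<bar>v\<^sup>j v\<^sup>k \<bar>v\<^sup>l\<close> at \<open>p\<close>, computed in the chart \<open>\<alpha>\<close>. For a Hermitian metric the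
  sum is real, since \<open>R\<^bsub>j\<bar>il\<bar>k\<^esub>\<close> is the conjugate of \<open>R\<^bsub>i\<bar>jk\<bar>l\<^esub>\<close>; \<open>Re\<close> only adjusts the type.\<close>

definition curv_form ::
  "('a, 'n::finite) chart set \<Rightarrow> ('a, 'n) metric \<Rightarrow> ('a, 'n) chart \<Rightarrow> 'a \<Rightarrow> ('a, 'n) tvec \<Rightarrow> real"
  where
  "curv_form A g \<alpha> p v = Re (\<Sum>i\<in>UNIV. \<Sum>j\<in>UNIV. \<Sum>k\<in>UNIV. \<Sum>l\<in>UNIV.
     chern_curvature A g \<alpha> i j k l (snd \<alpha> p)
       * (v \<alpha> $ i) * cnj (v \<alpha> $ j) * (v \<alpha> $ k) * cnj (v \<alpha> $ l))"

definition hsc_satisfies ::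
  "(real \<Rightarrow> bool) \<Rightarrow> 'a topology \<Rightarrow> ('a, 'n::finite) chart set \<Rightarrow> ('a, 'n) metric \<Rightarrow> bool" where
  "hsc_satisfies P X A g \<longleftrightarrow>
     (\<forall>p\<in>topspace X. \<forall>\<alpha>\<in>A. p \<in> fst \<alpha> \<longrightarrow>
        (\<forall>v\<in>tangent_space A p. v \<noteq> (\<lambda>\<beta>. 0) \<longrightarrow> P (curv_form A g \<alpha> p v)))"

abbreviation "hsc_positive \<equiv> hsc_satisfies (\<lambda>r. r > 0)"
abbreviation "hsc_nonnegative \<equiv> hsc_satisfies (\<lambda>r. r \<ge> 0)"
abbreviation "hsc_nonpositive \<equiv> hsc_satisfies (\<lambda>r. r \<le> 0)"
abbreviation "hsc_negative \<equiv> hsc_satisfies (\<lambda>r. r < 0)"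

end

theory Submission
  imports Defs "HOL-Complex_Analysis.Cauchy_Integral_Formula"
begin

text \<open>Consider the stretch \<open>\<bar>f\<^sub>* v\<bar>\<^sup>2 / \<bar>v\<bar>\<^sup>2\<close> of nonzero holomorphic tangent vectors \<open>v\<close> of the source \<open>M\<close>. It is
continuous and homogeneous of degree zero, and \<open>M\<close> is compact, so it attains a maximum \<open>C\<close>
(\<open>stretch_attains_sup\<close>). If \<open>C = 0\<close>, then the differential of \<open>f\<close> vanishes and \<open>f\<close> is constant, because \<open>M\<close>
is connected (\<open>constant_if_stretch_nonpos\<close>). It remains to exclude \<open>C > 0\<close>.

Let the maximum be attained at \<open>v\<close>, a vector at \<open>q\<close>. For every holomorphic disc \<open>\<gamma>\<close> through \<open>q\<close> with velocity
\<open>v\<close>, the function \<open>C \<bar>\<gamma>'\<bar>\<^sup>2 - \<bar>(f \<circ> \<gamma>)'\<bar>\<^sup>2\<close> of the disc parameter is nonnegative and vanishes at \<open>0\<close>, so its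
Laplacian at \<open>0\<close> is nonnegative. The Laplacian of the squared speed of a disc is
\<open>4 (\<bar>w\<bar>\<^sup>2 - R(v, v, v, v))\<close>, where \<open>R(v, v, v, v)\<close> is the curvature form at the velocity and \<open>w\<close> the covariant
derivative of the velocity for the Chern connection (\<open>has_jet2_laplacian_norm_velocity\<close>). In coordinates
\<open>\<gamma>\<close> can be chosen as a quadratic polynomial with \<open>w = 0\<close>, whereas for \<open>f \<circ> \<gamma>\<close> the term \<open>\<bar>w\<bar>\<^sup>2\<close> is
nonnegative. Therefore \<open>C R\<^sub>M(v, v, v, v) \<le> R\<^sub>N(f\<^sub>* v, f\<^sub>* v, f\<^sub>* v, f\<^sub>* v)\<close>
(\<open>curvature_comparison_at_max\<close>). Both vectors are nonzero, so under either curvature hypothesis the two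
sides have signs that contradict this inequality.

Working along discs keeps everything in one complex variable. The image disc is holomorphic there, so it
has derivatives of all orders, and the maximum principle is the second derivative test on the two real
lines in the directions \<open>1\<close> and \<open>\<i>\<close>. The continuity of the differential of \<open>f\<close> that the maximum requires
comes from the Cauchy inequality.\<close>

section \<open>Second-order Taylor data along a real line\<close>

text \<open>The derivatives of orders one and two at \<open>0\<close>. A holomorphic disc is studied below through its
restrictions to the two real lines in the directions \<open>1\<close> and \<open>\<i>\<close>, so that a Laplacian is a sum of
two numbers \<open>q\<close>.\<close>

definition has_jet2 :: "(real \<Rightarrow> 'a::real_normed_vector) \<Rightarrow> 'a \<Rightarrow> 'a \<Rightarrow> bool" where
  "has_jet2 \<phi> p q \<longleftrightarrow> (\<exists>\<phi>'. (\<forall>\<^sub>F s in nhds 0. (\<phi> has_vector_derivative \<phi>' s) (at s)) \<and>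
     \<phi>' 0 = p \<and> (\<phi>' has_vector_derivative q) (at 0))"

lemma has_jet2_const: "has_jet2 (\<lambda>_. c) 0 0"
  unfolding has_jet2_def by (rule exI[of _ "\<lambda>_. 0"]) auto

lemma has_jet2_add:
  assumes "has_jet2 \<phi> p q" "has_jet2 \<psi> p' q'"
  shows "has_jet2 (\<lambda>s. \<phi> s + \<psi> s) (p + p') (q + q')"
proof -
  obtain \<phi>' where 1: "\<forall>\<^sub>F s in nhds 0. (\<phi> has_vector_derivative \<phi>' s) (at s)" "\<phi>' 0 = p"
    "(\<phi>' has_vector_derivative q) (at 0)" using assms(1) unfolding has_jet2_def by blast
  obtain \<psi>' where 2: "\<forall>\<^sub>F s in nhds 0. (\<psi> has_vector_derivative \<psi>' s) (at s)" "\<psi>' 0 = p'"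
    "(\<psi>' has_vector_derivative q') (at 0)" using assms(2) unfolding has_jet2_def by blast
  have "\<forall>\<^sub>F s in nhds 0. ((\<lambda>s. \<phi> s + \<psi> s) has_vector_derivative \<phi>' s + \<psi>' s) (at s)"
    using 1(1) 2(1) by eventually_elim (rule has_vector_derivative_add)
  moreover have "((\<lambda>s. \<phi>' s + \<psi>' s) has_vector_derivative q + q') (at 0)"
    using 1(3) 2(3) by (rule has_vector_derivative_add)
  ultimately show ?thesis unfolding has_jet2_def using 1(2) 2(2) by auto
qed

lemma has_jet2_bounded_linear:
  assumes L: "bounded_linear L" and "has_jet2 \<phi> p q"
  shows "has_jet2 (\<lambda>s. L (\<phi> s)) (L p) (L q)"
proof -
  obtain \<phi>' where 1: "\<forall>\<^sub>F s in nhds 0. (\<phi> has_vector_derivative \<phi>' s) (at s)" "\<phi>' 0 = p"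
    "(\<phi>' has_vector_derivative q) (at 0)" using assms(2) unfolding has_jet2_def by blast
  have "\<forall>\<^sub>F s in nhds 0. ((\<lambda>s. L (\<phi> s)) has_vector_derivative L (\<phi>' s)) (at s)"
    using 1(1) by eventually_elim (rule bounded_linear.has_vector_derivative[OF L])
  moreover have "((\<lambda>s. L (\<phi>' s)) has_vector_derivative L q) (at 0)"
    using 1(3) by (rule bounded_linear.has_vector_derivative[OF L])
  ultimately show ?thesis unfolding has_jet2_def using 1(2) by auto
qed

lemma has_jet2_sum:
  assumes "finite I" "\<And>i. i \<in> I \<Longrightarrow> has_jet2 (\<phi> i) (p i) (q i)"
  shows "has_jet2 (\<lambda>s. \<Sum>i\<in>I. \<phi> i s) (\<Sum>i\<in>I. p i) (\<Sum>i\<in>I. q i)"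
  using assms by (induction I rule: finite_induct) (auto intro!: has_jet2_add has_jet2_const)

lemma has_jet2_mult:
  fixes \<phi> \<psi> :: "real \<Rightarrow> complex"
  assumes "has_jet2 \<phi> p q" "has_jet2 \<psi> p' q'"
  shows "has_jet2 (\<lambda>s. \<phi> s * \<psi> s) (p * \<psi> 0 + \<phi> 0 * p') (q * \<psi> 0 + 2 * p * p' + \<phi> 0 * q')"
proof -
  obtain \<phi>' where 1: "\<forall>\<^sub>F s in nhds 0. (\<phi> has_vector_derivative \<phi>' s) (at s)" "\<phi>' 0 = p"
    "(\<phi>' has_vector_derivative q) (at 0)" using assms(1) unfolding has_jet2_def by blast
  obtain \<psi>' where 2: "\<forall>\<^sub>F s in nhds 0. (\<psi> has_vector_derivative \<psi>' s) (at s)" "\<psi>' 0 = p'"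
    "(\<psi>' has_vector_derivative q') (at 0)" using assms(2) unfolding has_jet2_def by blast
  have \<phi>0: "(\<phi> has_vector_derivative p) (at 0)" using eventually_nhds_x_imp_x[OF 1(1)] 1(2) by simp
  have \<psi>0: "(\<psi> has_vector_derivative p') (at 0)" using eventually_nhds_x_imp_x[OF 2(1)] 2(2) by simp
  have "\<forall>\<^sub>F s in nhds 0. ((\<lambda>s. \<phi> s * \<psi> s) has_vector_derivative \<phi> s * \<psi>' s + \<phi>' s * \<psi> s) (at s)"
    using 1(1) 2(1) by eventually_elim (rule has_vector_derivative_mult)
  moreover have "((\<lambda>s. \<phi> s * \<psi>' s + \<phi>' s * \<psi> s) has_vector_derivative
      (\<phi> 0 * q' + p * \<psi>' 0) + (\<phi>' 0 * p' + q * \<psi> 0)) (at 0)"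
    by (intro has_vector_derivative_add has_vector_derivative_mult \<phi>0 \<psi>0 1 2)
  ultimately show ?thesis unfolding has_jet2_def using 1(2) 2(2)
    by (intro exI[of _ "\<lambda>s. \<phi> s * \<psi>' s + \<phi>' s * \<psi> s"]) (auto simp: algebra_simps)
qed

text \<open>At a minimum the first derivative vanishes. If the second one were negative, the first derivative
would be negative just to the right of \<open>0\<close>, and the mean value theorem would give a smaller value
there.\<close>

lemma has_jet2_local_min:
  fixes \<phi> :: "real \<Rightarrow> real"
  assumes "has_jet2 \<phi> p q" and min: "\<forall>\<^sub>F s in nhds 0. \<phi> 0 \<le> \<phi> s"
  shows "q \<ge> 0"
proof (rule ccontr)
  assume "\<not> q \<ge> 0"
  obtain \<phi>' where 1: "\<forall>\<^sub>F s in nhds 0. (\<phi> has_vector_derivative \<phi>' s) (at s)"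
    "(\<phi>' has_vector_derivative q) (at 0)" using assms(1) unfolding has_jet2_def by blast
  obtain d where d: "d > 0" "\<And>s. \<bar>s\<bar> < d \<Longrightarrow> (\<phi> has_real_derivative \<phi>' s) (at s) \<and> \<phi> 0 \<le> \<phi> s"
    using eventually_conj[OF 1(1) min] unfolding eventually_nhds_metric
    by (auto simp: has_real_derivative_iff_has_vector_derivative)
  have "\<phi>' 0 = 0" using DERIV_local_min[of \<phi> "\<phi>' 0" 0 d] d by (simp add: abs_minus_commute)
  moreover have "(\<phi>' has_real_derivative q) (at 0)"
    using 1(2) by (simp add: has_real_derivative_iff_has_vector_derivative)
  ultimately obtain d' where d': "d' > 0" "\<And>s. 0 < s \<Longrightarrow> s < d' \<Longrightarrow> \<phi>' s < 0"
    using DERIV_neg_dec_right[of \<phi>' q 0] \<open>\<not> q \<ge> 0\<close> by auto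
  define s where "s = min d d' / 2"
  have s: "0 < s" "s < d" "s < d'" using d(1) d'(1) by (auto simp: s_def)
  obtain z where z: "0 < z" "z < s" "\<phi> s - \<phi> 0 = (s - 0) * \<phi>' z"
    using MVT2[of 0 s \<phi> \<phi>'] s d(2) by fastforce
  have "\<phi>' z < 0" using d'(2)[of z] z(1,2) s by linarith
  then have "(s - 0) * \<phi>' z < 0" using s by (simp add: mult_pos_neg)
  then show False using z(3) d(2)[of s] s by simp
qed

section \<open>Wirtinger derivatives along curves\<close>

text \<open>A real-linear map on \<open>\<complex>\<^sup>n\<close> is the sum of a complex-linear and a conjugate-linear one; the Wirtinger
derivatives are the coefficients of these two parts of the differential.\<close>

lemma frechet_derivative_wirtinger:
  fixes F :: "complex^'n::finite \<Rightarrow> complex"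
  assumes "F differentiable (at z)"
  shows "frechet_derivative F (at z) u = (\<Sum>j\<in>UNIV. u $ j * dz j F z + cnj (u $ j) * dzbar j F z)"
proof -
  let ?D = "frechet_derivative F (at z)"
  have lin: "linear ?D"
    using assms by (rule linear_frechet_derivative)
  have u: "u = (\<Sum>j\<in>UNIV. Re (u $ j) *\<^sub>R axis j 1 + Im (u $ j) *\<^sub>R axis j \<i>)"
    by (simp add: vec_eq_iff axis_def if_distrib[of "\<lambda>x. _ *\<^sub>R x"] sum.distrib complex_eq_iff
        cong: if_cong)
  have "?D u = (\<Sum>j\<in>UNIV. Re (u $ j) *\<^sub>R ?D (axis j 1) + Im (u $ j) *\<^sub>R ?D (axis j \<i>))"
    by (subst u) (simp add: linear_sum[OF lin] linear_add[OF lin] linear_cmul[OF lin])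
  also have "\<dots> = (\<Sum>j\<in>UNIV. u $ j * dz j F z + cnj (u $ j) * dzbar j F z)"
    by (rule sum.cong) (simp_all add: dz_def dzbar_def complex_eq_iff field_simps)
  finally show ?thesis .
qed

lemma has_vector_derivative_wirtinger_chain:
  fixes F :: "complex^'n::finite \<Rightarrow> complex"
  assumes c: "(c has_vector_derivative c') (at s)" and F: "F differentiable (at (c s))"
  shows "((\<lambda>s. F (c s)) has_vector_derivative
    (\<Sum>j\<in>UNIV. c' $ j * dz j F (c s) + cnj (c' $ j) * dzbar j F (c s))) (at s)"
proof -
  have "(F has_derivative frechet_derivative F (at (c s))) (at (c s))"
    using F by (simp add: frechet_derivative_works)
  then have "(F \<circ> c has_vector_derivative frechet_derivative F (at (c s)) c') (at s)"
    using diff_chain_at[OF c[unfolded has_vector_derivative_def]]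
      linear_cmul[OF linear_frechet_derivative[OF F]]
    by (fastforce simp: has_vector_derivative_def o_def)
  then show ?thesis using frechet_derivative_wirtinger[OF F] by (simp add: o_def)
qed

text \<open>This is the regularity that the curvature formula uses: each first-order Wirtinger derivative can be
differentiated once more. The second derivatives enter through the real part of a Hermitian sum, in
which the two orders of a mixed derivative give conjugate contributions. The argument therefore never
exchanges derivatives.\<close>

definition wirtinger_C2 :: "(complex^'n::finite) set \<Rightarrow> (complex^'n \<Rightarrow> complex) \<Rightarrow> bool" where
  "wirtinger_C2 S F \<longleftrightarrow> (\<forall>z\<in>S. F differentiable (at z) \<and>
     (\<forall>i. dz i F differentiable (at z) \<and> dzbar i F differentiable (at z)))"

lemma smooth_on_imp_wirtinger_C2:
  assumes "smooth_on F S"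
  shows "wirtinger_C2 S F"
proof -
  have "Ck_on (Suc (Suc 0)) F S" using assms unfolding smooth_on_def by blast
  then have 1: "\<forall>x\<in>S. F differentiable (at x)"
    and 2: "\<And>v x. x \<in> S \<Longrightarrow> (\<lambda>x. frechet_derivative F (at x) v) differentiable (at x)" by auto
  have "dz i F differentiable (at x)" "dzbar i F differentiable (at x)" if "x \<in> S" for i x
    unfolding dz_def[abs_def] dzbar_def[abs_def] divide_inverse
    by (intro differentiable_mult differentiable_add differentiable_diff differentiable_const 2 that)+
  then show ?thesis unfolding wirtinger_C2_def using 1 by blast
qed

text \<open>For the velocity \<open>e *s a\<close> and the acceleration \<open>e\<^sup>2 *s b\<close> of a disc in direction \<open>e\<close>, the pure
second-order terms below carry the factor \<open>e\<^sup>2\<close> or its conjugate, and only the mixed ones carry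
\<open>e * cnj e\<close>. Adding the cases \<open>e = 1\<close> and \<open>e = \<i>\<close> therefore leaves the mixed terms.\<close>

lemma has_jet2_wirtinger_chain:
  fixes F :: "complex^'n::finite \<Rightarrow> complex"
  assumes S: "open S" "c 0 \<in> S" and F: "wirtinger_C2 S F" and c: "has_jet2 c p q"
  shows "has_jet2 (\<lambda>s. F (c s))
    (\<Sum>j\<in>UNIV. p $ j * dz j F (c 0) + cnj (p $ j) * dzbar j F (c 0))
    (\<Sum>j\<in>UNIV. q $ j * dz j F (c 0) + cnj (q $ j) * dzbar j F (c 0)
       + (\<Sum>i\<in>UNIV. p $ j * p $ i * dz i (dz j F) (c 0) + p $ j * cnj (p $ i) * dzbar i (dz j F) (c 0)
         + cnj (p $ j) * p $ i * dz i (dzbar j F) (c 0)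
         + cnj (p $ j) * cnj (p $ i) * dzbar i (dzbar j F) (c 0)))"
proof -
  obtain c' where 1: "\<forall>\<^sub>F s in nhds 0. (c has_vector_derivative c' s) (at s)" "c' 0 = p"
    "(c' has_vector_derivative q) (at 0)" using c unfolding has_jet2_def by blast
  have c0: "(c has_vector_derivative p) (at 0)" using eventually_nhds_x_imp_x[OF 1(1)] 1(2) by simp
  have "isCont c 0" using c0 by (rule has_vector_derivative_continuous)
  then have "\<forall>\<^sub>F s in nhds 0. c s \<in> S"
    using S by (intro topological_tendstoD[of c "c 0"]) (auto simp: isCont_def tendsto_at_iff_tendsto_nhds)
  then have "\<forall>\<^sub>F s in nhds 0. ((\<lambda>s. F (c s)) has_vector_derivative
    (\<Sum>j\<in>UNIV. c' s $ j * dz j F (c s) + cnj (c' s $ j) * dzbar j F (c s))) (at s)"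
    using 1(1)
  proof eventually_elim
    case (elim s)
    then show ?case using F has_vector_derivative_wirtinger_chain[of c "c' s" s F]
      unfolding wirtinger_C2_def by blast
  qed
  moreover have "((\<lambda>s. \<Sum>j\<in>UNIV. c' s $ j * dz j F (c s) + cnj (c' s $ j) * dzbar j F (c s))
     has_vector_derivative (\<Sum>j\<in>UNIV.
       (c' 0 $ j * (\<Sum>i\<in>UNIV. p $ i * dz i (dz j F) (c 0) + cnj (p $ i) * dzbar i (dz j F) (c 0))
         + q $ j * dz j F (c 0))
     + (cnj (c' 0 $ j) * (\<Sum>i\<in>UNIV. p $ i * dz i (dzbar j F) (c 0)
         + cnj (p $ i) * dzbar i (dzbar j F) (c 0)) + cnj (q $ j) * dzbar j F (c 0)))) (at 0)"
    using F S(2) unfolding wirtinger_C2_def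
    by (intro has_vector_derivative_sum has_vector_derivative_add has_vector_derivative_mult
         has_vector_derivative_wirtinger_chain c0
         bounded_linear.has_vector_derivative[OF bounded_linear_vec_nth 1(3)]
         bounded_linear.has_vector_derivative[OF bounded_linear_compose[OF bounded_linear_cnj bounded_linear_vec_nth] 1(3)])
       auto
  ultimately show ?thesis unfolding has_jet2_def using 1(2)
    by (intro exI[of _ "\<lambda>s. \<Sum>j\<in>UNIV. c' s $ j * dz j F (c s) + cnj (c' s $ j) * dzbar j F (c s)"])
       (auto simp: algebra_simps sum.distrib sum_distrib_left)
qed

section \<open>Hermitian forms and the curvature of their coefficients\<close>

definition herm_form :: "('n::finite \<Rightarrow> 'n \<Rightarrow> complex^'n \<Rightarrow> complex) \<Rightarrow> complex^'n \<Rightarrow> complex^'n \<Rightarrow> complex^'n \<Rightarrow> complex"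
  where "herm_form G z a b = (\<Sum>k\<in>UNIV. \<Sum>l\<in>UNIV. G k l z * a $ k * cnj (b $ l))"

text \<open>The curvature form in a chart depends only on the coefficient functions of the metric in that chart.
This version of it, for arbitrary coefficient functions on \<open>\<complex>\<^sup>n\<close>, keeps the local computation free
of manifolds.\<close>

definition coeff_curv :: "('n::finite \<Rightarrow> 'n \<Rightarrow> complex^'n \<Rightarrow> complex) \<Rightarrow> complex^'n \<Rightarrow> complex^'n \<Rightarrow> real"
  where "coeff_curv G z v = Re (\<Sum>i\<in>UNIV. \<Sum>j\<in>UNIV. \<Sum>k\<in>UNIV. \<Sum>l\<in>UNIV.
     (- dz i (dzbar j (G k l)) z
       + (\<Sum>p\<in>UNIV. \<Sum>q\<in>UNIV. matrix_inv (\<chi> r s. G r s z) $ q $ p * dz i (G k q) z * dzbar j (G p l) z))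
       * (v $ i) * cnj (v $ j) * (v $ k) * cnj (v $ l))"

lemma curv_form_eq_coeff_curv:
  "curv_form A g \<alpha> p v = coeff_curv (metric_coeff A g \<alpha>) (snd \<alpha> p) (v \<alpha>)"
  by (simp add: curv_form_def coeff_curv_def chern_curvature_def metric_inv_coeff_def)

definition hermitian_coeffs :: "('n::finite \<Rightarrow> 'n \<Rightarrow> complex^'n \<Rightarrow> complex) \<Rightarrow> (complex^'n) set \<Rightarrow> bool"
  where "hermitian_coeffs G S \<longleftrightarrow> open S \<and> (\<forall>k l. wirtinger_C2 S (G k l)) \<and>
     (\<forall>z\<in>S. \<forall>k l. G k l z = cnj (G l k z)) \<and> (\<forall>z\<in>S. \<forall>a. a \<noteq> 0 \<longrightarrow> Re (herm_form G z a a) > 0)"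

lemma herm_form_diff_left: "herm_form G z (a - b) c = herm_form G z a c - herm_form G z b c"
  by (simp add: herm_form_def algebra_simps sum_subtractf)

lemma herm_form_diff_right: "herm_form G z c (a - b) = herm_form G z c a - herm_form G z c b"
  by (simp add: herm_form_def algebra_simps sum_subtractf)

lemma herm_form_cnj:
  assumes "\<And>k l. G k l z = cnj (G l k z)"
  shows "herm_form G z b a = cnj (herm_form G z a b)"
proof -
  have "cnj (herm_form G z a b) = (\<Sum>k\<in>UNIV. \<Sum>l\<in>UNIV. G l k z * b $ l * cnj (a $ k))"
    unfolding herm_form_def cnj_sum
    by (intro sum.cong refl) (simp add: assms[symmetric] mult.commute mult.left_commute)
  also have "\<dots> = herm_form G z b a" unfolding herm_form_def by (rule sum.swap)
  finally show ?thesis by simp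
qed

lemma frechet_derivative_cong_open:
  assumes "open S" "z \<in> S" "\<And>x. x \<in> S \<Longrightarrow> F x = F' x"
  shows "frechet_derivative F (at z) = frechet_derivative F' (at z)"
proof -
  have "(F has_derivative D) (at z) \<longleftrightarrow> (F' has_derivative D) (at z)" for D
    using has_derivative_transform_within_open[OF _ assms(1,2), of F D UNIV F']
      has_derivative_transform_within_open[OF _ assms(1,2), of F' D UNIV F] assms(3) by auto
  then show ?thesis by (simp add: frechet_derivative_def)
qed

lemma frechet_derivative_cnj:
  assumes "F differentiable (at z)"
  shows "frechet_derivative (\<lambda>x. cnj (F x)) (at z) v = cnj (frechet_derivative F (at z) v)"
proof -
  have "((\<lambda>x. cnj (F x)) has_derivative (\<lambda>v. cnj (frechet_derivative F (at z) v))) (at z)"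
    using assms by (intro has_derivative_cnj) (simp add: frechet_derivative_works)
  then show ?thesis using frechet_derivative_at by metis
qed

lemma dzbar_eq_cnj_dz:
  assumes "open S" "z \<in> S" "\<And>x. x \<in> S \<Longrightarrow> F x = cnj (F' x)" "F' differentiable (at z)"
  shows "dzbar i F z = cnj (dz i F' z)" "dz i F z = cnj (dzbar i F' z)"
  using frechet_derivative_cong_open[OF assms(1-3)] frechet_derivative_cnj[OF assms(4)]
  by (auto simp: dz_def dzbar_def)

lemma hermitian_coeffs_deriv:
  assumes G: "hermitian_coeffs G S" and z: "z \<in> S"
  shows "dzbar j (G k l) z = cnj (dz j (G l k) z)"
    and "dzbar i (dz j (G k l)) z = cnj (dz i (dzbar j (G l k)) z)"
proof -
  have S: "open S" and C2: "wirtinger_C2 S (G l k)" and sym: "\<And>x. x \<in> S \<Longrightarrow> G k l x = cnj (G l k x)"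
    using G unfolding hermitian_coeffs_def by blast+
  show "dzbar j (G k l) z = cnj (dz j (G l k) z)"
    using z C2 by (intro dzbar_eq_cnj_dz(1)[OF S z sym]) (auto simp: wirtinger_C2_def)
  have 1: "dz j (G k l) x = cnj (dzbar j (G l k) x)" if "x \<in> S" for x
    using that C2 by (intro dzbar_eq_cnj_dz(2)[OF S that sym]) (auto simp: wirtinger_C2_def)
  show "dzbar i (dz j (G k l)) z = cnj (dz i (dzbar j (G l k)) z)"
    using z C2 by (intro dzbar_eq_cnj_dz(1)[OF S z 1]) (auto simp: wirtinger_C2_def)
qed

text \<open>In terms of the Christoffel symbols of the Chern connection this is the vector with components
\<open>- \<Gamma>\<^sup>p\<^sub>i\<^sub>k v\<^sup>i v\<^sup>k\<close>: the acceleration for which the velocity of a holomorphic disc through \<open>z\<close> with velocity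
\<open>v\<close> is parallel at \<open>z\<close>.\<close>

definition parallel_accel :: "('n::finite \<Rightarrow> 'n \<Rightarrow> complex^'n \<Rightarrow> complex) \<Rightarrow> complex^'n \<Rightarrow> complex^'n \<Rightarrow> complex^'n"
  where "parallel_accel G z v = (\<chi> p. - (\<Sum>q\<in>UNIV. matrix_inv (\<chi> r s. G r s z) $ q $ p *
     (\<Sum>k\<in>UNIV. \<Sum>i\<in>UNIV. dz i (G k q) z * v $ i * v $ k)))"

text \<open>The entrywise conjugate of a kernel vector of the coefficient matrix would have norm zero.\<close>

lemma matrix_inv_left_of_pos_def:
  assumes "\<And>a. a \<noteq> 0 \<Longrightarrow> Re (herm_form G z a a) > 0"
  shows "matrix_inv (\<chi> r s. G r s z) ** (\<chi> r s. G r s z) = mat 1"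
proof -
  let ?M = "\<chi> r s. G r s z"
  have "x = 0" if "?M *v x = 0" for x
  proof (rule ccontr)
    assume "x \<noteq> 0"
    then have "(\<chi> k. cnj (x $ k)) \<noteq> 0" by (auto simp: vec_eq_iff)
    from assms[OF this] have "Re (\<Sum>k\<in>UNIV. cnj (x $ k) * (?M *v x) $ k) > 0"
      by (simp add: herm_form_def matrix_vector_mult_def sum_distrib_left mult_ac)
    then show False using that by simp
  qed
  then have "invertible ?M" 
    by (simp add: invertible_left_inverse matrix_left_invertible_ker)
  then show ?thesis unfolding invertible_def matrix_inv_def by (rule someI2_ex) auto
qed

text \<open>This linear system characterises the acceleration: it says that the derivative of
\<open>G\<^bsub>p\<bar>l\<^esub> v\<^sup>p\<close> along the disc vanishes for every \<open>l\<close>.\<close>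

lemma parallel_accel_eq:
  assumes "\<And>a. a \<noteq> 0 \<Longrightarrow> Re (herm_form G z a a) > 0"
  shows "(\<Sum>p\<in>UNIV. G p l z * parallel_accel G z v $ p)
    = - (\<Sum>k\<in>UNIV. \<Sum>i\<in>UNIV. dz i (G k l) z * v $ i * v $ k)"
proof -
  let ?I = "matrix_inv (\<chi> r s. G r s z)"
  let ?x = "\<lambda>q. (\<Sum>k\<in>UNIV. \<Sum>i\<in>UNIV. dz i (G k q) z * v $ i * v $ k)"
  have I: "(\<Sum>p\<in>UNIV. ?I $ q $ p * G p l z) = (if q = l then 1 else 0)" for q
    using matrix_inv_left_of_pos_def[OF assms]
    by (simp add: vec_eq_iff matrix_matrix_mult_def mat_def)
  have "(\<Sum>p\<in>UNIV. G p l z * parallel_accel G z v $ p)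
      = - (\<Sum>p\<in>UNIV. \<Sum>q\<in>UNIV. ?x q * (?I $ q $ p * G p l z))"
    by (simp add: parallel_accel_def sum_distrib_left mult_ac sum_negf)
  also have "\<dots> = - (\<Sum>q\<in>UNIV. ?x q * (\<Sum>p\<in>UNIV. ?I $ q $ p * G p l z))"
    by (subst sum.swap) (simp add: sum_distrib_left)
  also have "\<dots> = - ?x l" unfolding I by (simp add: if_distrib cong: if_cong)
  finally show ?thesis .
qed

lemma sum_pull_out4:
  "(\<Sum>i\<in>I. \<Sum>j\<in>J. \<Sum>k\<in>K. \<Sum>l\<in>L. \<Sum>p\<in>P. t i j k l p) = (\<Sum>p\<in>P. \<Sum>i\<in>I. \<Sum>j\<in>J. \<Sum>k\<in>K. \<Sum>l\<in>L. t i j k l p)"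
proof -
  have "(\<Sum>i\<in>I. \<Sum>j\<in>J. \<Sum>k\<in>K. \<Sum>l\<in>L. \<Sum>p\<in>P. t i j k l p) = (\<Sum>i\<in>I. \<Sum>j\<in>J. \<Sum>k\<in>K. \<Sum>p\<in>P. \<Sum>l\<in>L. t i j k l p)"
    by (rule sum.cong[OF refl])+ (rule sum.swap)
  also have "\<dots> = (\<Sum>i\<in>I. \<Sum>j\<in>J. \<Sum>p\<in>P. \<Sum>k\<in>K. \<Sum>l\<in>L. t i j k l p)"
    by (rule sum.cong[OF refl], rule sum.cong[OF refl], rule sum.swap)
  also have "\<dots> = (\<Sum>i\<in>I. \<Sum>p\<in>P. \<Sum>j\<in>J. \<Sum>k\<in>K. \<Sum>l\<in>L. t i j k l p)"
    by (rule sum.cong[OF refl], rule sum.swap)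
  also have "\<dots> = (\<Sum>p\<in>P. \<Sum>i\<in>I. \<Sum>j\<in>J. \<Sum>k\<in>K. \<Sum>l\<in>L. t i j k l p)" by (rule sum.swap)
  finally show ?thesis .
qed

lemma sum_swap_blocks4: "(\<Sum>i\<in>I. \<Sum>j\<in>J. \<Sum>k\<in>K. \<Sum>l\<in>L. t i j k l) = (\<Sum>k\<in>K. \<Sum>l\<in>L. \<Sum>j\<in>J. \<Sum>i\<in>I. t i j k l)"
proof -
  have "(\<Sum>i\<in>I. \<Sum>j\<in>J. \<Sum>k\<in>K. \<Sum>l\<in>L. t i j k l) = (\<Sum>i\<in>I. \<Sum>k\<in>K. \<Sum>j\<in>J. \<Sum>l\<in>L. t i j k l)"
    by (rule sum.cong[OF refl], rule sum.swap)
  also have "\<dots> = (\<Sum>k\<in>K. \<Sum>i\<in>I. \<Sum>j\<in>J. \<Sum>l\<in>L. t i j k l)" by (rule sum.swap)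
  also have "\<dots> = (\<Sum>k\<in>K. \<Sum>i\<in>I. \<Sum>l\<in>L. \<Sum>j\<in>J. t i j k l)"
    by (rule sum.cong[OF refl], rule sum.cong[OF refl], rule sum.swap)
  also have "\<dots> = (\<Sum>k\<in>K. \<Sum>l\<in>L. \<Sum>i\<in>I. \<Sum>j\<in>J. t i j k l)"
    by (rule sum.cong[OF refl], rule sum.swap)
  also have "\<dots> = (\<Sum>k\<in>K. \<Sum>l\<in>L. \<Sum>j\<in>J. \<Sum>i\<in>I. t i j k l)"
    by (rule sum.cong[OF refl], rule sum.cong[OF refl], rule sum.swap)
  finally show ?thesis .
qed

text \<open>Contracting the inverse metric with one first derivative of the metric gives the parallel
acceleration, up to sign. So the quadratic first-order term of the curvature is its squared norm, and
the inverse matrix disappears from the formula.\<close>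

lemma coeff_curv_parallel_accel:
  assumes G: "hermitian_coeffs G S" and z: "z \<in> S"
  shows "coeff_curv G z v = Re (herm_form G z (parallel_accel G z v) (parallel_accel G z v))
    - Re (\<Sum>k\<in>UNIV. \<Sum>l\<in>UNIV. (\<Sum>j\<in>UNIV. \<Sum>i\<in>UNIV. cnj (v $ j) * v $ i * dz i (dzbar j (G k l)) z)
            * v $ k * cnj (v $ l))"
proof -
  let ?I = "matrix_inv (\<chi> r s. G r s z)"
  let ?w = "parallel_accel G z v"
  let ?x = "\<lambda>q. (\<Sum>k\<in>UNIV. \<Sum>i\<in>UNIV. dz i (G k q) z * v $ i * v $ k)"
  have pos: "\<And>a. a \<noteq> 0 \<Longrightarrow> Re (herm_form G z a a) > 0" and sym: "\<And>k l. G k l z = cnj (G l k z)"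
    using G z unfolding hermitian_coeffs_def by blast+
  have cnjx: "cnj (?x p) = (\<Sum>l\<in>UNIV. \<Sum>j\<in>UNIV. dzbar j (G p l) z * cnj (v $ j) * cnj (v $ l))" for p
    by (simp add: hermitian_coeffs_deriv[OF G z])
  have 1: "(\<Sum>i\<in>UNIV. \<Sum>j\<in>UNIV. \<Sum>k\<in>UNIV. \<Sum>l\<in>UNIV. - dz i (dzbar j (G k l)) z
       * (v $ i) * cnj (v $ j) * (v $ k) * cnj (v $ l)) =
    - (\<Sum>k\<in>UNIV. \<Sum>l\<in>UNIV. (\<Sum>j\<in>UNIV. \<Sum>i\<in>UNIV. cnj (v $ j) * v $ i * dz i (dzbar j (G k l)) z)
            * v $ k * cnj (v $ l))"
    by (subst sum_swap_blocks4) (simp add: sum_distrib_left sum_distrib_right sum_negf mult_ac)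
  have "(\<Sum>i\<in>UNIV. \<Sum>j\<in>UNIV. \<Sum>k\<in>UNIV. \<Sum>l\<in>UNIV.
       (\<Sum>p\<in>UNIV. \<Sum>q\<in>UNIV. ?I $ q $ p * dz i (G k q) z * dzbar j (G p l) z)
       * (v $ i) * cnj (v $ j) * (v $ k) * cnj (v $ l))
    = (\<Sum>i\<in>UNIV. \<Sum>j\<in>UNIV. \<Sum>k\<in>UNIV. \<Sum>l\<in>UNIV. \<Sum>p\<in>UNIV. \<Sum>q\<in>UNIV.
       ?I $ q $ p * dz i (G k q) z * dzbar j (G p l) z
       * (v $ i) * cnj (v $ j) * (v $ k) * cnj (v $ l))"
    by (simp add: sum_distrib_right)
  also have "\<dots> = (\<Sum>p\<in>UNIV. \<Sum>q\<in>UNIV. \<Sum>i\<in>UNIV. \<Sum>j\<in>UNIV. \<Sum>k\<in>UNIV. \<Sum>l\<in>UNIV.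
       ?I $ q $ p * dz i (G k q) z * dzbar j (G p l) z
       * (v $ i) * cnj (v $ j) * (v $ k) * cnj (v $ l))"
    by (subst sum_pull_out4, rule sum.cong[OF refl], rule sum_pull_out4)
  also have "\<dots> = (\<Sum>p\<in>UNIV. \<Sum>q\<in>UNIV. ?I $ q $ p * ?x q * cnj (?x p))"
  proof (rule sum.cong[OF refl], rule sum.cong[OF refl])
    fix p q
    have "(\<Sum>i\<in>UNIV. \<Sum>j\<in>UNIV. \<Sum>k\<in>UNIV. \<Sum>l\<in>UNIV. ?I $ q $ p * dz i (G k q) z * dzbar j (G p l) z
       * (v $ i) * cnj (v $ j) * (v $ k) * cnj (v $ l))
      = (\<Sum>k\<in>UNIV. \<Sum>l\<in>UNIV. \<Sum>j\<in>UNIV. \<Sum>i\<in>UNIV. ?I $ q $ p * dz i (G k q) z * dzbar j (G p l) z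
       * (v $ i) * cnj (v $ j) * (v $ k) * cnj (v $ l))" by (rule sum_swap_blocks4)
    also have "\<dots> = (\<Sum>k\<in>UNIV. \<Sum>l\<in>UNIV. ?I $ q $ p * ((\<Sum>i\<in>UNIV. dz i (G k q) z * v $ i * v $ k)
       * (\<Sum>j\<in>UNIV. dzbar j (G p l) z * cnj (v $ j) * cnj (v $ l))))"
      by (rule sum.cong[OF refl], rule sum.cong[OF refl])
        (simp add: sum_product sum_distrib_left sum_distrib_right mult_ac)
    also have "\<dots> = ?I $ q $ p * (?x q * cnj (?x p))"
      unfolding cnjx by (simp only: sum_product sum_distrib_left[symmetric])
    finally show "(\<Sum>i\<in>UNIV. \<Sum>j\<in>UNIV. \<Sum>k\<in>UNIV. \<Sum>l\<in>UNIV. ?I $ q $ p * dz i (G k q) z * dzbar j (G p l) z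
       * (v $ i) * cnj (v $ j) * (v $ k) * cnj (v $ l)) = ?I $ q $ p * ?x q * cnj (?x p)"
      by (simp only: mult.assoc)
  qed
  also have "\<dots> = (\<Sum>p\<in>UNIV. ?w $ p * (- cnj (?x p)))"
    by (simp add: parallel_accel_def flip: sum_distrib_right)
  also have "\<dots> = (\<Sum>p\<in>UNIV. ?w $ p * (\<Sum>l\<in>UNIV. G p l z * cnj (?w $ l)))"
  proof (rule sum.cong[OF refl])
    fix p
    have "- cnj (?x p) = cnj (- ?x p)" by simp
    also have "\<dots> = (\<Sum>l\<in>UNIV. cnj (G l p z) * cnj (?w $ l))"
      by (subst parallel_accel_eq[OF pos, symmetric]) simp_all
    also have "\<dots> = (\<Sum>l\<in>UNIV. G p l z * cnj (?w $ l))" by (simp add: sym[symmetric])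
    finally show "?w $ p * (- cnj (?x p)) = ?w $ p * (\<Sum>l\<in>UNIV. G p l z * cnj (?w $ l))" by simp
  qed
  also have "\<dots> = herm_form G z ?w ?w"
    by (simp add: herm_form_def sum_distrib_left mult_ac)
  finally have 2: "(\<Sum>i\<in>UNIV. \<Sum>j\<in>UNIV. \<Sum>k\<in>UNIV. \<Sum>l\<in>UNIV.
       (\<Sum>p\<in>UNIV. \<Sum>q\<in>UNIV. ?I $ q $ p * dz i (G k q) z * dzbar j (G p l) z)
       * (v $ i) * cnj (v $ j) * (v $ k) * cnj (v $ l)) = herm_form G z ?w ?w" .
  show ?thesis unfolding coeff_curv_def distrib_right sum.distrib 1 2 by simp
qed

section \<open>The Laplacian of the squared speed of a holomorphic disc\<close>

text \<open>A complex-linear differential: \<open>\<delta>\<close> is complex differentiable at \<open>t\<close> with derivative \<open>v\<close>.\<close>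

definition has_velocity :: "(complex \<Rightarrow> complex^'n::finite) \<Rightarrow> complex^'n \<Rightarrow> complex \<Rightarrow> bool"
  where "has_velocity \<delta> v t \<longleftrightarrow> (\<delta> has_derivative (\<lambda>h. h *s v)) (at t)"

lemma has_velocity_along_line:
  assumes "has_velocity \<delta> v (of_real s * e)"
  shows "((\<lambda>s. \<delta> (of_real s * e)) has_vector_derivative e *s v) (at s)"
proof -
  have "((\<lambda>s::real. of_real s * e) has_derivative (\<lambda>h. of_real h * e)) (at s)"
    by (auto intro!: derivative_eq_intros)
  from diff_chain_at[OF this assms[unfolded has_velocity_def]]
  show ?thesis
    by (simp add: has_vector_derivative_def o_def scaleR_vec_def vector_scalar_mult_def scaleR_conv_of_real mult.assoc)
qed

lemma has_jet2_along_line: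
  fixes \<delta> :: "complex \<Rightarrow> complex^'n::finite"
  assumes T: "open T" "0 \<in> T" and \<delta>: "\<And>t. t \<in> T \<Longrightarrow> has_velocity \<delta> (\<delta>' t) t"
    and \<delta>': "has_velocity \<delta>' b 0"
  shows "has_jet2 (\<lambda>s. \<delta> (of_real s * e)) (e *s \<delta>' 0) (e\<^sup>2 *s b)"
proof -
  have "((\<lambda>s::real. of_real s * e) \<longlongrightarrow> of_real 0 * e) (nhds 0)"
    by (intro tendsto_intros filterlim_ident)
  then have "\<forall>\<^sub>F s::real in nhds 0. of_real s * e \<in> T"
    using T by (intro topological_tendstoD) auto
  then have "\<forall>\<^sub>F s in nhds 0. ((\<lambda>s. \<delta> (of_real s * e)) has_vector_derivative e *s \<delta>' (of_real s * e)) (at s)"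
    by eventually_elim (rule has_velocity_along_line[OF \<delta>])
  moreover have "((\<lambda>s. e *s \<delta>' (of_real s * e)) has_vector_derivative e *s (e *s b)) (at 0)"
  proof -
    have "bounded_linear (\<lambda>x. e *s x :: complex^'n)"
      by (subst linear_conv_bounded_linear[symmetric]) (auto simp: linear_iff vec_eq_iff algebra_simps)
    moreover have "((\<lambda>s. \<delta>' (of_real s * e)) has_vector_derivative e *s b) (at 0)"
      using has_velocity_along_line[of \<delta>' b 0 e] \<delta>' by simp
    ultimately show ?thesis by (rule bounded_linear.has_vector_derivative)
  qed
  ultimately show ?thesis unfolding has_jet2_def
    by (intro exI[of _ "\<lambda>s. e *s \<delta>' (of_real s * e)"]) (auto simp: power2_eq_square vector_smult_assoc)
qed

text \<open>The product rule for one summand of the squared speed. In direction \<open>e\<close> the derivative of the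
velocity is \<open>e *s \<delta>'' t\<close>, and the third derivative of the disc occurs only with the factors \<open>e\<^sup>2\<close> and
\<open>(cnj e)\<^sup>2\<close>. It cancels, like all terms with these factors, in the sum over \<open>e = 1\<close> and \<open>e = \<i>\<close>.\<close>

lemma has_jet2_laplacian_norm_velocity_term:
  fixes F :: "complex^'n::finite \<Rightarrow> complex" and k l :: 'n
  assumes S: "open S" "\<delta> 0 \<in> S" and F: "wirtinger_C2 S F"
    and T: "open T" "0 \<in> T"
    and \<delta>: "\<And>t. t \<in> T \<Longrightarrow> has_velocity \<delta> (\<delta>' t) t"
    and \<delta>': "\<And>t. t \<in> T \<Longrightarrow> has_velocity \<delta>' (\<delta>'' t) t" and \<delta>'': "has_velocity \<delta>'' c 0"
  defines "\<phi> \<equiv> \<lambda>e s. F (\<delta> (of_real s * e)) * \<delta>' (of_real s * e) $ k * cnj (\<delta>' (of_real s * e) $ l)"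
    and "a \<equiv> \<delta>' 0" and "b \<equiv> \<delta>'' 0" and "z \<equiv> \<delta> 0"
  shows "\<exists>p q p' q'. has_jet2 (\<phi> 1) p q \<and> has_jet2 (\<phi> \<i>) p' q' \<and>
    q + q' = 2 * (\<Sum>j\<in>UNIV. \<Sum>i\<in>UNIV. a $ j * cnj (a $ i) * dzbar i (dz j F) z) * a $ k * cnj (a $ l)
      + 2 * (\<Sum>j\<in>UNIV. \<Sum>i\<in>UNIV. cnj (a $ j) * a $ i * dz i (dzbar j F) z) * a $ k * cnj (a $ l)
      + 4 * (\<Sum>j\<in>UNIV. cnj (a $ j) * dzbar j F z) * b $ k * cnj (a $ l)
      + 4 * (\<Sum>j\<in>UNIV. a $ j * dz j F z) * a $ k * cnj (b $ l)
      + 4 * F z * b $ k * cnj (b $ l)"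
proof -
  define X where "X = (\<Sum>j\<in>UNIV. a $ j * dz j F z)"
  define Y where "Y = (\<Sum>j\<in>UNIV. cnj (a $ j) * dzbar j F z)"
  define U where "U = (\<Sum>j\<in>UNIV. b $ j * dz j F z + (\<Sum>i\<in>UNIV. a $ j * a $ i * dz i (dz j F) z))"
  define U' where "U' = (\<Sum>j\<in>UNIV. cnj (b $ j) * dzbar j F z
    + (\<Sum>i\<in>UNIV. cnj (a $ j) * cnj (a $ i) * dzbar i (dzbar j F) z))"
  define Z where "Z = (\<Sum>j\<in>UNIV. \<Sum>i\<in>UNIV. a $ j * cnj (a $ i) * dzbar i (dz j F) z)"
  define Z' where "Z' = (\<Sum>j\<in>UNIV. \<Sum>i\<in>UNIV. cnj (a $ j) * a $ i * dz i (dzbar j F) z)"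
  have F_jet: "has_jet2 (\<lambda>s. F (\<delta> (of_real s * e))) (e * X + cnj e * Y)
      (e\<^sup>2 * U + (cnj e)\<^sup>2 * U' + e * cnj e * (Z + Z'))" for e
  proof -
    have "has_jet2 (\<lambda>s. \<delta> (of_real s * e)) (e *s a) (e\<^sup>2 *s b)"
      using has_jet2_along_line[OF T \<delta> \<delta>'[OF T(2)]] by (simp add: a_def b_def)
    from has_jet2_wirtinger_chain[OF S(1) _ F this]
    show ?thesis using S(2)
      by (simp add: X_def Y_def U_def U'_def Z_def Z'_def z_def sum.distrib sum_distrib_left
         algebra_simps power2_eq_square)
  qed
  have a_jet: "has_jet2 (\<lambda>s. \<delta>' (of_real s * e) $ m) (e * b $ m) (e\<^sup>2 * c $ m)" for e m
    using has_jet2_bounded_linear[OF bounded_linear_vec_nth[of m] has_jet2_along_line[OF T \<delta>' \<delta>'', of e]]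
    by (simp add: b_def)
  have abar_jet: "has_jet2 (\<lambda>s. cnj (\<delta>' (of_real s * e) $ m)) (cnj (e * b $ m)) (cnj (e\<^sup>2 * c $ m))" for e m
    by (rule has_jet2_bounded_linear[OF bounded_linear_cnj a_jet])
  note jet = has_jet2_mult[OF has_jet2_mult[OF F_jet a_jet] abar_jet]
  have "\<exists>p q. has_jet2 (\<phi> 1) p q \<and> q = U * a $ k * cnj (a $ l) + U' * a $ k * cnj (a $ l)
      + (Z + Z') * a $ k * cnj (a $ l) + (X + Y) * (2 * b $ k * cnj (a $ l) + 2 * a $ k * cnj (b $ l))
      + F z * (c $ k * cnj (a $ l) + 2 * b $ k * cnj (b $ l) + a $ k * cnj (c $ l))"
    unfolding \<phi>_def by (rule exI, rule exI, rule conjI, rule jet) (simp add: a_def z_def algebra_simps)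
  moreover have "\<exists>p q. has_jet2 (\<phi> \<i>) p q \<and> q = - U * a $ k * cnj (a $ l) - U' * a $ k * cnj (a $ l)
      + (Z + Z') * a $ k * cnj (a $ l) + (X - Y) * (- 2 * b $ k * cnj (a $ l) + 2 * a $ k * cnj (b $ l))
      + F z * (- c $ k * cnj (a $ l) + 2 * b $ k * cnj (b $ l) - a $ k * cnj (c $ l))"
    unfolding \<phi>_def by (rule exI, rule exI, rule conjI, rule jet) (simp add: a_def z_def algebra_simps)
  ultimately show ?thesis unfolding X_def[symmetric] Y_def[symmetric] Z_def[symmetric] Z'_def[symmetric]
    by (elim exE conjE, intro exI conjI) (assumption, assumption, simp add: algebra_simps)
qed

text \<open>The left-hand side \<open>q + q'\<close> is the Laplacian at \<open>0\<close> of the squared speed of the disc. The terms that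
involve the acceleration complete to a square: what remains besides the curvature is the squared norm
of the covariant derivative \<open>w\<close> of the velocity. Hence the Laplacian is at least \<open>- 4\<close> times the
curvature, with equality for a disc of parallel acceleration.\<close>

lemma has_jet2_laplacian_norm_velocity:
  assumes G: "hermitian_coeffs G S" and S: "\<delta> 0 \<in> S"
    and T: "open T" "0 \<in> T"
    and \<delta>: "\<And>t. t \<in> T \<Longrightarrow> has_velocity \<delta> (\<delta>' t) t"
    and \<delta>': "\<And>t. t \<in> T \<Longrightarrow> has_velocity \<delta>' (\<delta>'' t) t" and \<delta>'': "has_velocity \<delta>'' c 0"
  defines "\<phi> \<equiv> \<lambda>e s. Re (herm_form G (\<delta> (of_real s * e)) (\<delta>' (of_real s * e)) (\<delta>' (of_real s * e)))"
    and "w \<equiv> \<delta>'' 0 - parallel_accel G (\<delta> 0) (\<delta>' 0)"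
  shows "\<exists>p q p' q'. has_jet2 (\<phi> 1) p q \<and> has_jet2 (\<phi> \<i>) p' q' \<and>
    q + q' = 4 * (Re (herm_form G (\<delta> 0) w w) - coeff_curv G (\<delta> 0) (\<delta>' 0))"
proof -
  define a where "a = \<delta>' 0"
  define b where "b = \<delta>'' 0"
  define z where "z = \<delta> 0"
  define \<Gamma> where "\<Gamma> = parallel_accel G z a"
  define X where "X k l = (\<Sum>j\<in>UNIV. a $ j * dz j (G k l) z)" for k l
  define Y where "Y k l = (\<Sum>j\<in>UNIV. cnj (a $ j) * dzbar j (G k l) z)" for k l
  define Z where "Z k l = (\<Sum>j\<in>UNIV. \<Sum>i\<in>UNIV. a $ j * cnj (a $ i) * dzbar i (dz j (G k l)) z)" for k l
  define Z' where "Z' k l = (\<Sum>j\<in>UNIV. \<Sum>i\<in>UNIV. cnj (a $ j) * a $ i * dz i (dzbar j (G k l)) z)" for k l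
  have open_S: "open S" and C2: "\<And>k l. wirtinger_C2 S (G k l)" and z: "z \<in> S"
    using G S unfolding hermitian_coeffs_def z_def by blast+
  have pos: "\<And>a. a \<noteq> 0 \<Longrightarrow> Re (herm_form G z a a) > 0" and sym: "\<And>k l. G k l z = cnj (G l k z)"
    using G z unfolding hermitian_coeffs_def by blast+
  let ?\<psi> = "\<lambda>k l e s. G k l (\<delta> (of_real s * e)) * \<delta>' (of_real s * e) $ k * cnj (\<delta>' (of_real s * e) $ l)"
  have "\<forall>k l. \<exists>p q p' q'. has_jet2 (?\<psi> k l 1) p q \<and> has_jet2 (?\<psi> k l \<i>) p' q' \<and>
    q + q' = 2 * Z k l * a $ k * cnj (a $ l) + 2 * Z' k l * a $ k * cnj (a $ l)
      + 4 * Y k l * b $ k * cnj (a $ l) + 4 * X k l * a $ k * cnj (b $ l) + 4 * G k l z * b $ k * cnj (b $ l)"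
    unfolding a_def b_def z_def X_def Y_def Z_def Z'_def
    by (intro allI has_jet2_laplacian_norm_velocity_term[OF open_S S C2 T \<delta> \<delta>' \<delta>''])
  then obtain p q p' q' where jet: "\<And>k l. has_jet2 (?\<psi> k l 1) (p k l) (q k l)"
    "\<And>k l. has_jet2 (?\<psi> k l \<i>) (p' k l) (q' k l)"
    and qq: "\<And>k l. q k l + q' k l = 2 * Z k l * a $ k * cnj (a $ l) + 2 * Z' k l * a $ k * cnj (a $ l)
      + 4 * Y k l * b $ k * cnj (a $ l) + 4 * X k l * a $ k * cnj (b $ l) + 4 * G k l z * b $ k * cnj (b $ l)"
    unfolding choice_iff by blast
  have jets: "has_jet2 (\<phi> 1) (Re (\<Sum>k\<in>UNIV. \<Sum>l\<in>UNIV. p k l)) (Re (\<Sum>k\<in>UNIV. \<Sum>l\<in>UNIV. q k l))"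
    "has_jet2 (\<phi> \<i>) (Re (\<Sum>k\<in>UNIV. \<Sum>l\<in>UNIV. p' k l)) (Re (\<Sum>k\<in>UNIV. \<Sum>l\<in>UNIV. q' k l))"
    unfolding \<phi>_def herm_form_def
    by (intro has_jet2_bounded_linear[OF bounded_linear_Re] has_jet2_sum jet finite)+
  let ?H = "herm_form G z"
  let ?s = "\<lambda>f. \<Sum>k\<in>UNIV. \<Sum>l\<in>UNIV. f k l"
  have Y: "Y k l = cnj (X l k)" for k l
    by (simp add: X_def Y_def hermitian_coeffs_deriv[OF G z])
  have Z: "Z k l = cnj (Z' l k)" for k l
    by (simp add: Z_def Z'_def hermitian_coeffs_deriv[OF G z])
  (* The two mixed second derivatives contribute conjugate sums, which have the same real part.
     The same holds for the two terms with one first derivative of the metric. *)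
  have "?s (\<lambda>k l. Z k l * a $ k * cnj (a $ l))
      = cnj (?s (\<lambda>k l. Z' k l * a $ k * cnj (a $ l)))"
    unfolding cnj_sum by (subst sum.swap) (simp add: Z mult_ac)
  then have ReZ: "Re (?s (\<lambda>k l. Z k l * a $ k * cnj (a $ l)))
      = Re (?s (\<lambda>k l. Z' k l * a $ k * cnj (a $ l)))" by (simp only: cnj.simps)
  have "?s (\<lambda>k l. Y k l * b $ k * cnj (a $ l))
      = cnj (?s (\<lambda>k l. X k l * a $ k * cnj (b $ l)))"
    unfolding cnj_sum by (subst sum.swap) (simp add: Y mult_ac)
  then have ReY: "Re (?s (\<lambda>k l. Y k l * b $ k * cnj (a $ l)))
      = Re (?s (\<lambda>k l. X k l * a $ k * cnj (b $ l)))" by (simp only: cnj.simps)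
  have X\<Gamma>: "?s (\<lambda>k l. X k l * a $ k * cnj (b $ l)) = - ?H \<Gamma> b"
  proof -
    have "?s (\<lambda>k l. X k l * a $ k * cnj (b $ l))
      = (\<Sum>l\<in>UNIV. (\<Sum>k\<in>UNIV. \<Sum>i\<in>UNIV. dz i (G k l) z * a $ i * a $ k) * cnj (b $ l))"
      by (subst sum.swap) (simp add: X_def sum_distrib_left sum_distrib_right mult_ac)
    also have "\<dots> = (\<Sum>l\<in>UNIV. - (\<Sum>p\<in>UNIV. G p l z * \<Gamma> $ p) * cnj (b $ l))"
      using parallel_accel_eq[OF pos, of _ a] by (simp add: \<Gamma>_def)
    also have "\<dots> = - ?H \<Gamma> b" unfolding herm_form_def
      by (subst sum.swap) (simp add: sum_distrib_right sum_negf)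
    finally show ?thesis .
  qed
  have w: "w = b - \<Gamma>" by (simp add: w_def b_def \<Gamma>_def z_def a_def)
  have Hw: "Re (?H w w) = Re (?H b b) - 2 * Re (?H \<Gamma> b) + Re (?H \<Gamma> \<Gamma>)"
    using herm_form_cnj[of G z b \<Gamma>, OF sym]
    by (simp add: w herm_form_diff_left herm_form_diff_right)
  have curv: "coeff_curv G z a = Re (?H \<Gamma> \<Gamma>) - Re (?s (\<lambda>k l. Z' k l * a $ k * cnj (a $ l)))"
    unfolding \<Gamma>_def Z'_def by (rule coeff_curv_parallel_accel[OF G z])
  have "?s q + ?s q' = ?s (\<lambda>k l. q k l + q' k l)" by (simp add: sum.distrib)
  also have "\<dots> = 2 * ?s (\<lambda>k l. Z k l * a $ k * cnj (a $ l)) + 2 * ?s (\<lambda>k l. Z' k l * a $ k * cnj (a $ l))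
      + 4 * ?s (\<lambda>k l. Y k l * b $ k * cnj (a $ l)) + 4 * ?s (\<lambda>k l. X k l * a $ k * cnj (b $ l))
      + 4 * ?H b b"
    by (simp only: qq sum.distrib herm_form_def sum_distrib_left mult.assoc)
  finally have "Re (?s q + ?s q') = 4 * Re (?s (\<lambda>k l. Z' k l * a $ k * cnj (a $ l)))
      - 8 * Re (?H \<Gamma> b) + 4 * Re (?H b b)"
    using ReZ ReY X\<Gamma> by simp
  then have "Re (?s q) + Re (?s q') = 4 * (Re (?H w w) - coeff_curv G z a)"
    using Hw curv by simp
  then show ?thesis using jets unfolding z_def a_def by blast
qed

section \<open>Holomorphic maps between coordinate domains\<close>

lemma norm_smult_vec: "norm (c *s v :: complex^'n::finite) = cmod c * norm v"
  by (simp add: norm_vec_def L2_set_def norm_mult power_mult_distrib real_sqrt_mult sum_distrib_left[symmetric])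

lemma has_velocity_component_iff:
  "has_velocity \<delta> v t \<longleftrightarrow> (\<forall>k. ((\<lambda>t. \<delta> t $ k) has_field_derivative v $ k) (at t))"
proof
  assume "has_velocity \<delta> v t"
  then have "((\<lambda>t. \<delta> t $ k) has_derivative (\<lambda>h. (h *s v) $ k)) (at t)" for k
    unfolding has_velocity_def by (rule bounded_linear.has_derivative[OF bounded_linear_vec_nth])
  then show "\<forall>k. ((\<lambda>t. \<delta> t $ k) has_field_derivative v $ k) (at t)"
    by (simp add: has_field_derivative_def mult_commute_abs)
next
  assume a: "\<forall>k. ((\<lambda>t. \<delta> t $ k) has_field_derivative v $ k) (at t)"
  have "((\<lambda>t. \<delta> t \<bullet> i) has_derivative (\<lambda>h. (h *s v) \<bullet> i)) (at t)" if i_Basis: "i \<in> Basis" for i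
  proof -
    obtain k and u :: complex where i: "i = axis k u" using i_Basis unfolding Basis_vec_def by auto
    have "((\<lambda>t. \<delta> t $ k) has_derivative (\<lambda>h. h * v $ k)) (at t)"
      using a by (simp add: has_field_derivative_def mult_commute_abs)
    then show ?thesis unfolding i by (simp add: inner_axis has_derivative_inner_left)
  qed
  then show "has_velocity \<delta> v t"
    unfolding has_velocity_def by (subst has_derivative_componentwise_within) auto
qed

lemma holo_on_derivative:
  assumes "holo_on F U" "z \<in> U"
  shows "(F has_derivative frechet_derivative F (at z)) (at z)"
    and "frechet_derivative F (at z) (c *s v) = c *s frechet_derivative F (at z) v"
proof -
  obtain D where D: "(F has_derivative D) (at z)" "\<And>c v. D (c *s v) = c *s D v"
    using assms unfolding holo_on_def by blast
  moreover have "frechet_derivative F (at z) = D" using frechet_derivative_at[OF D(1)] by simp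
  ultimately show "(F has_derivative frechet_derivative F (at z)) (at z)"
    "frechet_derivative F (at z) (c *s v) = c *s frechet_derivative F (at z) v" by auto
qed

lemma holo_on_imp_continuous_on: "holo_on F U \<Longrightarrow> continuous_on U F"
  by (rule continuous_at_imp_continuous_on) (blast intro: has_derivative_continuous[OF holo_on_derivative(1)])

lemma has_velocity_holo_comp:
  assumes F: "holo_on F U" "\<gamma> t \<in> U" and \<gamma>: "has_velocity \<gamma> v t"
  shows "has_velocity (\<lambda>t. F (\<gamma> t)) (frechet_derivative F (at (\<gamma> t)) v) t"
  using diff_chain_at[OF \<gamma>[unfolded has_velocity_def] holo_on_derivative(1)[OF F]]
  by (simp add: has_velocity_def o_def holo_on_derivative(2)[OF F])

lemma has_velocity_quadratic:
  "has_velocity (\<lambda>t. z + t *s v + (t\<^sup>2 / 2) *s w) (v + t *s w) t"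
  "has_velocity (\<lambda>t. v + t *s w) w t"
  "has_velocity (\<lambda>t. w) 0 t"
proof -
  have "((\<lambda>t. z $ k + t * v $ k + t\<^sup>2 / 2 * w $ k) has_field_derivative v $ k + t * w $ k) (at t)"
    "((\<lambda>t. v $ k + t * w $ k) has_field_derivative w $ k) (at t)" for k
    by (rule derivative_eq_intros refl | simp)+
  then show "has_velocity (\<lambda>t. z + t *s v + (t\<^sup>2 / 2) *s w) (v + t *s w) t"
    "has_velocity (\<lambda>t. v + t *s w) w t" "has_velocity (\<lambda>t. w) 0 t"
    by (simp_all add: has_velocity_component_iff)
qed

text \<open>The definition of a holomorphic map asks for derivatives at single points only. Their joint continuity
comes from one complex variable: the component \<open>k\<close> of the differential at \<open>z\<close> in direction \<open>v\<close> is the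
derivative at \<open>0\<close> of \<open>t \<mapsto> F (z + t *s v) $ k\<close>, and by the Cauchy inequality two such derivatives are
close when the functions are uniformly close on a fixed circle, which follows from the uniform
continuity of \<open>F\<close>.\<close>

lemma continuous_on_holo_derivative:
  fixes F :: "complex^'m::finite \<Rightarrow> complex^'n::finite"
  assumes F: "holo_on F U" and U: "open U"
  shows "continuous_on (U \<times> UNIV) (\<lambda>(z, v). frechet_derivative F (at z) v)"
proof (rule continuous_at_imp_continuous_on, safe)
  fix z0 v0 assume z0: "z0 \<in> U"
  let ?D = "\<lambda>z v. frechet_derivative F (at z) v"
  have "((\<lambda>p. ?D (fst p) (snd p) $ k) \<longlongrightarrow> ?D z0 v0 $ k) (at (z0, v0))" for k
  proof (rule tendstoI)
    fix e :: real assume e: "e > 0"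
    obtain \<rho> where \<rho>: "\<rho> > 0" "cball z0 \<rho> \<subseteq> U" using U z0 open_contains_cball by blast
    obtain n where n: "n = norm v0 + 1" "n > 0" using norm_ge_zero[of v0] by fastforce
    (* With this radius the discs t \<mapsto> z + t *s v stay in the compact ball for all (z, v) near (z0, v0). *)
    define r where "r = \<rho> / 2 / n"
    have r: "r > 0" "r * n = \<rho> / 2" using \<rho>(1) n(2) by (auto simp: r_def)
    have "uniformly_continuous_on (cball z0 \<rho>) F"
      using holo_on_imp_continuous_on[OF F] \<rho>(2)
      by (intro compact_uniformly_continuous) (auto intro: continuous_on_subset)
    then obtain \<eta> where \<eta>: "\<eta> > 0" "\<And>x y. x \<in> cball z0 \<rho> \<Longrightarrow> y \<in> cball z0 \<rho> \<Longrightarrow> dist y x < \<eta> \<Longrightarrow> dist (F y) (F x) < e * r / 2"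
      using e r(1) by (elim uniformly_continuous_onE[where \<epsilon> = "e * r / 2"]) simp_all
    have line: "z + t *s v \<in> cball z0 \<rho>" if "dist z z0 < \<rho> / 2" "norm v \<le> n" "cmod t \<le> r" for z v t
    proof -
      have "norm (t *s v) \<le> r * n"
        unfolding norm_smult_vec using that r(1) by (intro mult_mono) auto
      moreover have "dist z0 (z + t *s v) \<le> dist z z0 + norm (t *s v)"
        using norm_triangle_ineq[of "z - z0" "t *s v"]
        by (simp add: dist_norm norm_minus_commute algebra_simps)
      ultimately show ?thesis using that(1) r(2) by simp
    qed
    have fd: "((\<lambda>t. F (z + t *s v) $ k) has_field_derivative ?D (z + t *s v) v $ k) (at t)"
      if "dist z z0 < \<rho> / 2" "norm v \<le> n" "cmod t \<le> r" for z v t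
    proof -
      have "has_velocity (\<lambda>t. z + t *s v) v t"
        by (auto simp: has_velocity_component_iff intro!: derivative_eq_intros)
      from has_velocity_holo_comp[OF F _ this] show ?thesis
        using line[OF that] \<rho>(2) by (auto simp: has_velocity_component_iff)
    qed
    have close: "dist (?D z v $ k) (?D z0 v0 $ k) < e"
      if z: "dist z z0 < \<rho> / 2" "dist z z0 < \<eta> / 2" and v: "dist v v0 < 1" "r * dist v v0 < \<eta> / 2" for z v
    proof -
      let ?f = "\<lambda>t. F (z + t *s v) $ k - F (z0 + t *s v0) $ k"
      have nv: "norm v \<le> n"
        using v(1) norm_triangle_ineq2[of v v0] n(1) by (simp add: dist_norm)
      have df: "(?f has_field_derivative ?D (z + t *s v) v $ k - ?D (z0 + t *s v0) v0 $ k) (at t)"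
        if "cmod t \<le> r" for t
        using fd[OF z(1) nv that] fd[of z0 v0 t] \<rho>(1) n(1) that by (intro derivative_intros) auto
      have hol: "?f holomorphic_on cball 0 r"
        unfolding holomorphic_on_def field_differentiable_def
        by (intro ballI exI, rule has_field_derivative_at_within[OF df]) simp
      have "norm ((deriv ^^ 1) ?f 0) \<le> fact 1 * (e * r / 2) / r ^ 1"
      proof (rule Cauchy_inequality)
        show "?f holomorphic_on ball 0 r" using hol by (rule holomorphic_on_subset) auto
        show "continuous_on (cball 0 r) ?f" using hol by (rule holomorphic_on_imp_continuous_on)
        fix t :: complex assume "norm (0 - t) = r"
        then have t: "cmod t = r" by simp
        have zt: "z + t *s v \<in> cball z0 \<rho>" using t by (intro line[OF z(1) nv]) simp
        have z0t: "z0 + t *s v0 \<in> cball z0 \<rho>" using t \<rho>(1) n(1) by (intro line) simp_all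
        have "dist (z + t *s v) (z0 + t *s v0) \<le> dist z z0 + norm (t *s (v - v0))"
          using norm_triangle_ineq[of "z - z0" "t *s (v - v0)"]
          by (simp add: dist_norm vector_sub_rdistrib vector_ssub_ldistrib algebra_simps)
        also have "norm (t *s (v - v0)) = r * dist v v0" using t by (simp only: norm_smult_vec dist_norm)
        also have "dist z z0 + r * dist v v0 < \<eta>" using z(2) v(2) by simp
        finally have "dist (F (z + t *s v)) (F (z0 + t *s v0)) < e * r / 2"
          by (rule \<eta>(2)[OF z0t zt])
        then show "norm (?f t) \<le> e * r / 2"
          using Finite_Cartesian_Product.norm_nth_le[of "F (z + t *s v) - F (z0 + t *s v0)" k] by (simp add: dist_norm)
      qed (use r in auto)
      moreover have "deriv ?f 0 = ?D z v $ k - ?D z0 v0 $ k"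
        using df[of 0] r(1) by (intro DERIV_imp_deriv) simp
      ultimately have "norm (?D z v $ k - ?D z0 v0 $ k) \<le> e / 2" using r(1) by simp
      then show ?thesis using e by (simp add: dist_norm)
    qed
    have t1: "((\<lambda>p. dist (fst p) z0) \<longlongrightarrow> 0) (at (z0, v0))"
      and t2: "((\<lambda>p. dist (snd p) v0) \<longlongrightarrow> 0) (at (z0, v0))"
      by (auto intro!: tendsto_eq_intros)
    have t3: "((\<lambda>p. r * dist (snd p) v0) \<longlongrightarrow> 0) (at (z0, v0))"
      using tendsto_mult_left[OF t2, of r] by simp
    have "\<forall>\<^sub>F p in at (z0, v0). dist (fst p) z0 < \<rho> / 2" "\<forall>\<^sub>F p in at (z0, v0). dist (fst p) z0 < \<eta> / 2"
      "\<forall>\<^sub>F p in at (z0, v0). dist (snd p) v0 < 1" "\<forall>\<^sub>F p in at (z0, v0). r * dist (snd p) v0 < \<eta> / 2"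
      using \<rho>(1) \<eta>(1) order_tendstoD(2)[OF t1, of "\<rho> / 2"] order_tendstoD(2)[OF t1, of "\<eta> / 2"]
        order_tendstoD(2)[OF t2, of 1] order_tendstoD(2)[OF t3, of "\<eta> / 2"] by simp_all
    then show "\<forall>\<^sub>F p in at (z0, v0). dist (?D (fst p) (snd p) $ k) (?D z0 v0 $ k) < e"
      by eventually_elim (rule close)
  qed
  then show "isCont (\<lambda>(z, v). ?D z v) (z0, v0)"
    unfolding isCont_def case_prod_unfold by (simp add: vec_tendstoI)
qed

lemma has_jet2_cmult_diff:
  fixes \<phi> \<psi> :: "real \<Rightarrow> real"
  assumes "has_jet2 \<phi> p q" "has_jet2 \<psi> p' q'"
  shows "has_jet2 (\<lambda>s. C * \<phi> s - \<psi> s) (C * p - p') (C * q - q')"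
  using has_jet2_add[OF has_jet2_bounded_linear[OF bounded_linear_mult_right[of C] assms(1)]
      has_jet2_bounded_linear[OF bounded_linear_minus[OF bounded_linear_ident] assms(2)]]
  unfolding diff_conv_add_uminus .

text \<open>The maximum principle. Let \<open>\<gamma>\<close> be a disc through \<open>z\<close> with velocity \<open>v\<close>. By hypothesis
\<open>C\<close> times the squared speed of \<open>\<gamma>\<close> minus the squared speed of \<open>F \<circ> \<gamma>\<close> is nonnegative, and it vanishes at
\<open>0\<close>, so its Laplacian there is nonnegative. If \<open>\<gamma>\<close> has parallel acceleration, its own squared speed has
Laplacian exactly \<open>- 4\<close> times the curvature of \<open>H\<close>, while that of \<open>F \<circ> \<gamma>\<close> has at least \<open>- 4\<close> times the
curvature of \<open>G\<close>.\<close>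

lemma curvature_comparison_at_max:
  fixes F :: "complex^'m::finite \<Rightarrow> complex^'n::finite"
  assumes H: "hermitian_coeffs H U" and G: "hermitian_coeffs G S"
    and V: "open V" "V \<subseteq> U" "z \<in> V" and F: "holo_on F V" "F ` V \<subseteq> S"
    and le: "\<And>x u. x \<in> V \<Longrightarrow> Re (herm_form G (F x) (frechet_derivative F (at x) u) (frechet_derivative F (at x) u))
      \<le> C * Re (herm_form H x u u)"
    and eq: "Re (herm_form G (F z) (frechet_derivative F (at z) v) (frechet_derivative F (at z) v))
      = C * Re (herm_form H z v v)"
  shows "C * coeff_curv H z v \<le> coeff_curv G (F z) (frechet_derivative F (at z) v)"
proof -
  (* This acceleration makes the square in the Laplacian of the squared speed of \<gamma> vanish. For the
     image disc F \<circ> \<gamma> the square need not vanish, but it has the right sign. *)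
  define \<Gamma> where "\<Gamma> = parallel_accel H z v"
  define \<gamma> where "\<gamma> t = z + t *s v + (t\<^sup>2 / 2) *s \<Gamma>" for t
  define \<gamma>1 where "\<gamma>1 t = v + t *s \<Gamma>" for t
  define T where "T = \<gamma> -` V"
  define \<delta> where "\<delta> t = F (\<gamma> t)" for t
  define \<delta>' where "\<delta>' t = frechet_derivative F (at (\<gamma> t)) (\<gamma>1 t)" for t
  define \<delta>'' where "\<delta>'' t = (\<chi> k. deriv (\<lambda>t. \<delta>' t $ k) t)" for t
  define c where "c = (\<chi> k. deriv (\<lambda>t. \<delta>'' t $ k) 0)"
  have \<gamma>: "has_velocity \<gamma> (\<gamma>1 t) t" and \<gamma>1: "has_velocity \<gamma>1 \<Gamma> t" for t
    unfolding \<gamma>_def[abs_def] \<gamma>1_def[abs_def] by (rule has_velocity_quadratic)+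
  have \<gamma>0: "\<gamma> 0 = z" "\<gamma>1 0 = v" by (simp_all add: \<gamma>_def \<gamma>1_def)
  have "continuous_on UNIV \<gamma>"
    using has_derivative_continuous[OF \<gamma>[unfolded has_velocity_def]]
    by (simp add: continuous_on_eq_continuous_at)
  then have T: "open T" "0 \<in> T"
    unfolding T_def using V \<gamma>0 by (auto simp: continuous_on_open_vimage[OF open_UNIV])
  have \<delta>: "has_velocity \<delta> (\<delta>' t) t" if "t \<in> T" for t
    unfolding \<delta>_def[abs_def] \<delta>'_def using that by (intro has_velocity_holo_comp[OF F(1) _ \<gamma>]) (simp add: T_def)
  (* In one variable the derivative of a holomorphic function is holomorphic, which supplies the second
     and third derivatives of the image disc. *)
  have \<delta>'_hol: "(\<lambda>t. \<delta>' t $ k) holomorphic_on T" for k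
  proof -
    have d: "((\<lambda>t. \<delta> t $ k) has_field_derivative \<delta>' t $ k) (at t)" if "t \<in> T" for t
      using \<delta>[OF that] by (simp add: has_velocity_component_iff)
    then have "(\<lambda>t. \<delta> t $ k) holomorphic_on T"
      using T(1) holomorphic_on_open by blast
    then have "deriv (\<lambda>t. \<delta> t $ k) holomorphic_on T" using T(1) by (rule holomorphic_deriv)
    then show ?thesis
      by (rule holomorphic_transform) (use d in \<open>auto intro: DERIV_imp_deriv\<close>)
  qed
  have \<delta>': "has_velocity \<delta>' (\<delta>'' t) t" if "t \<in> T" for t
    using holomorphic_derivI[OF \<delta>'_hol T(1) that] by (simp add: has_velocity_component_iff \<delta>''_def)
  have \<delta>''_hol: "(\<lambda>t. \<delta>'' t $ k) holomorphic_on T" for k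
    using holomorphic_deriv[OF \<delta>'_hol T(1)] by (simp add: \<delta>''_def)
  have \<delta>'': "has_velocity \<delta>'' c 0"
    using holomorphic_derivI[OF \<delta>''_hol T] by (simp add: has_velocity_component_iff c_def)
  define \<phi> where "\<phi> e s = Re (herm_form H (\<gamma> (of_real s * e)) (\<gamma>1 (of_real s * e)) (\<gamma>1 (of_real s * e)))" for e and s :: real
  define \<psi> where "\<psi> e s = Re (herm_form G (\<delta> (of_real s * e)) (\<delta>' (of_real s * e)) (\<delta>' (of_real s * e)))" for e and s :: real
  let ?w = "\<delta>'' 0 - parallel_accel G (\<delta> 0) (\<delta>' 0)"
  have "\<gamma> 0 \<in> U" "\<delta> 0 \<in> S" using V(2,3) F(2) by (auto simp: \<delta>_def \<gamma>0)
  have "\<exists>p q p' q'. has_jet2 (\<phi> 1) p q \<and> has_jet2 (\<phi> \<i>) p' q' \<and>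
    q + q' = 4 * (Re (herm_form H (\<gamma> 0) (\<Gamma> - parallel_accel H (\<gamma> 0) (\<gamma>1 0)) (\<Gamma> - parallel_accel H (\<gamma> 0) (\<gamma>1 0)))
       - coeff_curv H (\<gamma> 0) (\<gamma>1 0))"
    unfolding \<phi>_def
    by (rule has_jet2_laplacian_norm_velocity[where \<delta>'' = "\<lambda>_. \<Gamma>" and T = UNIV and S = U and c = 0])
       (use H \<gamma> \<gamma>1 \<open>\<gamma> 0 \<in> U\<close> has_velocity_quadratic(3) in auto)
  then obtain p q p' q' where \<phi>: "has_jet2 (\<phi> 1) p q" "has_jet2 (\<phi> \<i>) p' q'" "q + q' = - 4 * coeff_curv H z v"
    unfolding \<gamma>0 \<Gamma>_def by (auto simp: herm_form_def)
  have "\<exists>p q p' q'. has_jet2 (\<psi> 1) p q \<and> has_jet2 (\<psi> \<i>) p' q' \<and>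
    q + q' = 4 * (Re (herm_form G (\<delta> 0) ?w ?w) - coeff_curv G (\<delta> 0) (\<delta>' 0))"
    unfolding \<psi>_def
    by (rule has_jet2_laplacian_norm_velocity[OF G \<open>\<delta> 0 \<in> S\<close> T \<delta> \<delta>' \<delta>''])
  then obtain p2 q2 p2' q2' where \<psi>: "has_jet2 (\<psi> 1) p2 q2" "has_jet2 (\<psi> \<i>) p2' q2'"
    "q2 + q2' = 4 * (Re (herm_form G (\<delta> 0) ?w ?w) - coeff_curv G (\<delta> 0) (\<delta>' 0))" by blast
  have "Re (herm_form G (\<delta> 0) x x) \<ge> 0" for x
  proof (cases "x = 0")
    case True
    then show ?thesis by (simp add: herm_form_def)
  next
    case False
    then show ?thesis using G \<open>\<delta> 0 \<in> S\<close> unfolding hermitian_coeffs_def by (simp add: less_imp_le)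
  qed
  from this[of ?w] have \<psi>_ge: "q2 + q2' \<ge> - 4 * coeff_curv G (F z) (frechet_derivative F (at z) v)"
    using \<psi>(3) by (simp add: \<delta>_def \<delta>'_def \<gamma>0)
  have min: "\<forall>\<^sub>F s in nhds 0. C * \<phi> e 0 - \<psi> e 0 \<le> C * \<phi> e s - \<psi> e s" for e
  proof -
    have "((\<lambda>s::real. of_real s * e) \<longlongrightarrow> of_real 0 * e) (nhds 0)"
      by (intro tendsto_intros filterlim_ident)
    then have "\<forall>\<^sub>F s::real in nhds 0. of_real s * e \<in> T"
      using T by (intro topological_tendstoD) auto
    then show ?thesis
    proof eventually_elim
      case (elim s)
      then have "\<psi> e s \<le> C * \<phi> e s" unfolding \<psi>_def \<phi>_def \<delta>_def \<delta>'_def T_def by (intro le) auto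
      moreover have "\<psi> e 0 = C * \<phi> e 0" using eq by (simp add: \<psi>_def \<phi>_def \<delta>_def \<delta>'_def \<gamma>0)
      ultimately show ?case by simp
    qed
  qed
  have "C * q - q2 \<ge> 0" "C * q' - q2' \<ge> 0"
    using has_jet2_local_min[OF has_jet2_cmult_diff[OF \<phi>(1) \<psi>(1)] min]
      has_jet2_local_min[OF has_jet2_cmult_diff[OF \<phi>(2) \<psi>(2)] min] by auto
  then have "C * (q + q') \<ge> q2 + q2'" by (simp add: distrib_left)
  moreover have "C * (q + q') = C * (- 4 * coeff_curv H z v)" using \<phi>(3) by (rule arg_cong)
  ultimately show ?thesis using \<psi>_ge by simp
qed

section \<open>Charts, tangent vectors and metrics\<close>

context
  fixes X :: "'a topology" and A :: "('a, 'n::finite) chart set"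
  assumes X: "complex_manifold X A"
begin

lemma chart_open: "\<alpha> \<in> A \<Longrightarrow> openin X (fst \<alpha>)"
  and chart_image_open: "\<alpha> \<in> A \<Longrightarrow> open (snd \<alpha> ` fst \<alpha>)"
  and chart_homeomorphic: "\<alpha> \<in> A \<Longrightarrow>
    homeomorphic_map (subtopology X (fst \<alpha>)) (top_of_set (snd \<alpha> ` fst \<alpha>)) (snd \<alpha>)"
  and charts_cover: "p \<in> topspace X \<Longrightarrow> \<exists>\<alpha>\<in>A. p \<in> fst \<alpha>"
  using X unfolding complex_manifold_def by blast+

lemma topspace_chart: "\<alpha> \<in> A \<Longrightarrow> topspace (subtopology X (fst \<alpha>)) = fst \<alpha>"
  by (simp add: Int_absorb1 openin_subset[OF chart_open])

lemma chart_inj: "\<alpha> \<in> A \<Longrightarrow> inj_on (snd \<alpha>) (fst \<alpha>)"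
  using homeomorphic_imp_injective_map[OF chart_homeomorphic] topspace_chart by metis

lemma chart_inv_chart: "\<alpha> \<in> A \<Longrightarrow> p \<in> fst \<alpha> \<Longrightarrow> chart_inv \<alpha> (snd \<alpha> p) = p"
  using chart_inj by (simp add: chart_inv_def)

lemma open_chart_image:
  assumes \<alpha>: "\<alpha> \<in> A" and W: "openin X W" "W \<subseteq> fst \<alpha>"
  shows "open (snd \<alpha> ` W)"
proof -
  have "openin (subtopology X (fst \<alpha>)) W"
    using W openin_open_subtopology[OF chart_open[OF \<alpha>]] by simp
  then have "openin (top_of_set (snd \<alpha> ` fst \<alpha>)) (snd \<alpha> ` W)"
    using homeomorphic_imp_open_map[OF chart_homeomorphic[OF \<alpha>]] by (simp add: open_map_def)
  then show ?thesis using chart_image_open[OF \<alpha>] by (simp add: openin_open_eq)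
qed

lemma openin_chart_preimage:
  assumes \<alpha>: "\<alpha> \<in> A" and S: "open S"
  shows "openin X {p \<in> fst \<alpha>. snd \<alpha> p \<in> S}"
proof -
  have "openin (subtopology X (fst \<alpha>)) {p \<in> topspace (subtopology X (fst \<alpha>)). snd \<alpha> p \<in> snd \<alpha> ` fst \<alpha> \<inter> S}"
    using S by (intro openin_continuous_map_preimage[OF homeomorphic_imp_continuous_map[OF chart_homeomorphic[OF \<alpha>]]]) auto
  also have "{p \<in> topspace (subtopology X (fst \<alpha>)). snd \<alpha> p \<in> snd \<alpha> ` fst \<alpha> \<inter> S} = {p \<in> fst \<alpha>. snd \<alpha> p \<in> S}"
    unfolding topspace_chart[OF \<alpha>] by auto
  finally show ?thesis using chart_open[OF \<alpha>] openin_trans_full by blast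
qed

lemma holomorphic_map_id: "holomorphic_map X A X A id"
  using X unfolding complex_manifold_def holomorphic_map_def transition_def by simp

end

definition local_rep :: "('a, 'm::finite) chart \<Rightarrow> ('b, 'n::finite) chart \<Rightarrow> ('a \<Rightarrow> 'b) \<Rightarrow> complex^'m \<Rightarrow> complex^'n"
  where "local_rep \<alpha> \<beta> f = snd \<beta> \<circ> f \<circ> chart_inv \<alpha>"

definition local_deriv :: "('a, 'm::finite) chart \<Rightarrow> ('b, 'n::finite) chart \<Rightarrow> ('a \<Rightarrow> 'b) \<Rightarrow> 'a \<Rightarrow> complex^'m \<Rightarrow> complex^'n"
  where "local_deriv \<alpha> \<beta> f p = frechet_derivative (local_rep \<alpha> \<beta> f) (at (snd \<alpha> p))"

definition rep_dom :: "('a, 'm::finite) chart \<Rightarrow> ('b, 'n::finite) chart \<Rightarrow> ('a \<Rightarrow> 'b) \<Rightarrow> (complex^'m) set"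
  where "rep_dom \<alpha> \<beta> f = snd \<alpha> ` (fst \<alpha> \<inter> f -` fst \<beta>)"

lemma transition_eq_local_rep: "transition \<alpha> \<beta> = local_rep \<alpha> \<beta> id"
  by (simp add: transition_def local_rep_def)

lemma rep_domI: "p \<in> fst \<alpha> \<Longrightarrow> f p \<in> fst \<beta> \<Longrightarrow> snd \<alpha> p \<in> rep_dom \<alpha> \<beta> f"
  by (auto simp: rep_dom_def)

lemma local_rep_chart:
  assumes "complex_manifold X A" "\<alpha> \<in> A" "p \<in> fst \<alpha>"
  shows "local_rep \<alpha> \<beta> f (snd \<alpha> p) = snd \<beta> (f p)"
  using chart_inv_chart[OF assms] by (simp add: local_rep_def)

lemma open_rep_dom:
  assumes "complex_manifold X A" "complex_manifold Y B" "holomorphic_map X A Y B f" "\<alpha> \<in> A" "\<beta> \<in> B"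
  shows "open (rep_dom \<alpha> \<beta> f)"
proof -
  have "openin X {p \<in> fst \<alpha>. f p \<in> fst \<beta>}"
    using assms(3) unfolding holomorphic_map_def
    by (intro openin_continuous_map_preimage_gen[of X Y] chart_open[OF assms(1,4)] chart_open[OF assms(2,5)]) simp
  moreover have "fst \<alpha> \<inter> f -` fst \<beta> = {p \<in> fst \<alpha>. f p \<in> fst \<beta>}" by auto
  ultimately show ?thesis unfolding rep_dom_def using assms by (intro open_chart_image[of X A]) auto
qed

lemma holo_on_local_rep:
  assumes "holomorphic_map X A Y B f" "\<alpha> \<in> A" "\<beta> \<in> B"
  shows "holo_on (local_rep \<alpha> \<beta> f) (rep_dom \<alpha> \<beta> f)"
  using assms unfolding holomorphic_map_def local_rep_def rep_dom_def by blast

lemma local_deriv: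
  assumes "holomorphic_map X A Y B f" "\<alpha> \<in> A" "\<beta> \<in> B" "p \<in> fst \<alpha>" "f p \<in> fst \<beta>"
  shows has_derivative_local_rep: "(local_rep \<alpha> \<beta> f has_derivative local_deriv \<alpha> \<beta> f p) (at (snd \<alpha> p))"
    and local_deriv_smult: "local_deriv \<alpha> \<beta> f p (c *s u) = c *s local_deriv \<alpha> \<beta> f p u"
    and local_deriv_add: "local_deriv \<alpha> \<beta> f p (u + u') = local_deriv \<alpha> \<beta> f p u + local_deriv \<alpha> \<beta> f p u'"
proof -
  show d: "(local_rep \<alpha> \<beta> f has_derivative local_deriv \<alpha> \<beta> f p) (at (snd \<alpha> p))"
    unfolding local_deriv_def using assms
    by (intro holo_on_derivative(1)[OF holo_on_local_rep] rep_domI)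
  show "local_deriv \<alpha> \<beta> f p (c *s u) = c *s local_deriv \<alpha> \<beta> f p u"
    unfolding local_deriv_def using assms
    by (intro holo_on_derivative(2)[OF holo_on_local_rep] rep_domI)
  show "local_deriv \<alpha> \<beta> f p (u + u') = local_deriv \<alpha> \<beta> f p u + local_deriv \<alpha> \<beta> f p u'"
    using has_derivative_linear[OF d] by (rule linear_add)
qed

text \<open>Since a transition map is the local representative of the identity, this one chain rule also covers the
cocycle rule for Jacobians and the change of charts in the source and in the target of a map.\<close>

lemma local_deriv_comp:
  assumes X: "complex_manifold X A" and Y: "complex_manifold Y B"
    and f: "holomorphic_map X A Y B f" and g: "holomorphic_map Y B Z C g"
    and charts: "\<alpha> \<in> A" "\<beta> \<in> B" "\<gamma> \<in> C" and p: "p \<in> fst \<alpha>" "f p \<in> fst \<beta>" "g (f p) \<in> fst \<gamma>"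
  shows "local_deriv \<alpha> \<gamma> (g \<circ> f) p u = local_deriv \<beta> \<gamma> g (f p) (local_deriv \<alpha> \<beta> f p u)"
proof -
  have F: "(local_rep \<alpha> \<beta> f has_derivative local_deriv \<alpha> \<beta> f p) (at (snd \<alpha> p))"
    using f charts p by (intro has_derivative_local_rep)
  have G: "(local_rep \<beta> \<gamma> g has_derivative local_deriv \<beta> \<gamma> g (f p)) (at (local_rep \<alpha> \<beta> f (snd \<alpha> p)))"
    unfolding local_rep_chart[OF X charts(1) p(1)] using g charts p by (intro has_derivative_local_rep)
  have "(local_rep \<alpha> \<gamma> (g \<circ> f) has_derivative local_deriv \<beta> \<gamma> g (f p) \<circ> local_deriv \<alpha> \<beta> f p) (at (snd \<alpha> p))"
  proof (rule has_derivative_transform_within_open[OF diff_chain_at[OF F G]])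
    show "open (rep_dom \<alpha> \<beta> f)" using X Y f charts by (intro open_rep_dom)
    show "snd \<alpha> p \<in> rep_dom \<alpha> \<beta> f" using p by (intro rep_domI)
    fix x assume "x \<in> rep_dom \<alpha> \<beta> f"
    then obtain q where "q \<in> fst \<alpha>" "f q \<in> fst \<beta>" "x = snd \<alpha> q" by (auto simp: rep_dom_def)
    then show "(local_rep \<beta> \<gamma> g \<circ> local_rep \<alpha> \<beta> f) x = local_rep \<alpha> \<gamma> (g \<circ> f) x"
      using X Y charts by (simp add: local_rep_chart)
  qed
  from fun_cong[OF frechet_derivative_at[OF this], of u]
  show ?thesis by (simp only: local_deriv_def[of \<alpha> \<gamma>] o_apply)
qed

lemma local_deriv_id:
  assumes X: "complex_manifold X A" and \<alpha>: "\<alpha> \<in> A" "p \<in> fst \<alpha>"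
  shows "local_deriv \<alpha> \<alpha> id p u = u"
proof -
  have "(local_rep \<alpha> \<alpha> id has_derivative id) (at (snd \<alpha> p))"
    by (rule has_derivative_transform_within_open[OF has_derivative_id chart_image_open[OF X \<alpha>(1)]])
       (use \<alpha> local_rep_chart[OF X \<alpha>(1), of _ \<alpha> id] in \<open>auto simp del: split_paired_All\<close>)
  from frechet_derivative_at[OF this] show ?thesis by (metis local_deriv_def id_apply)
qed

text \<open>The element of \<open>tangent_space A p\<close> with coordinates \<open>u\<close> in the chart \<open>\<alpha>\<close>.\<close>

definition tangent_vec :: "('a, 'n::finite) chart set \<Rightarrow> ('a, 'n) chart \<Rightarrow> 'a \<Rightarrow> complex^'n \<Rightarrow> ('a, 'n) tvec"
  where "tangent_vec A \<alpha> p u = (\<lambda>\<beta>. if \<beta> \<in> A \<and> p \<in> fst \<beta> then local_deriv \<alpha> \<beta> id p u else 0)"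

lemma coord_vec_eq_tangent_vec: "coord_vec A \<alpha> p i = tangent_vec A \<alpha> p (axis i 1)"
  unfolding coord_vec_def tangent_vec_def local_deriv_def transition_eq_local_rep ..

context
  fixes X :: "'a topology" and A :: "('a, 'n::finite) chart set" and \<alpha> :: "('a, 'n) chart" and p :: 'a
  assumes X: "complex_manifold X A" and \<alpha>: "\<alpha> \<in> A" "p \<in> fst \<alpha>"
begin

lemma tangent_vec_self: "tangent_vec A \<alpha> p u \<alpha> = u"
  using \<alpha> by (simp add: tangent_vec_def local_deriv_id[OF X \<alpha>])

lemma local_deriv_transition:
  assumes "\<beta> \<in> A" "\<gamma> \<in> A" "p \<in> fst \<beta>" "p \<in> fst \<gamma>"
  shows "local_deriv \<beta> \<gamma> id p (local_deriv \<alpha> \<beta> id p u) = local_deriv \<alpha> \<gamma> id p u"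
  using local_deriv_comp[OF X X holomorphic_map_id[OF X] holomorphic_map_id[OF X], of \<alpha> \<beta> \<gamma> p u] assms \<alpha>
  by simp

lemma tangent_vec_change_chart:
  assumes "\<beta> \<in> A" "p \<in> fst \<beta>"
  shows "tangent_vec A \<beta> p (local_deriv \<alpha> \<beta> id p u) = tangent_vec A \<alpha> p u"
  using assms by (auto simp: tangent_vec_def local_deriv_transition)

lemma tangent_vec_in_tangent_space: "tangent_vec A \<alpha> p u \<in> tangent_space A p"
  unfolding tangent_space_def transition_eq_local_rep
  by (auto simp: tangent_vec_def local_deriv_transition simp flip: local_deriv_def)

lemma tangent_vec_add:
  "tangent_vec A \<alpha> p (u + u') = (\<lambda>\<beta>. tangent_vec A \<alpha> p u \<beta> + tangent_vec A \<alpha> p u' \<beta>)"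
  using local_deriv_add[OF holomorphic_map_id[OF X] \<alpha>(1) _ \<alpha>(2)]
  by (auto simp: tangent_vec_def fun_eq_iff)

lemma tangent_vec_smult:
  "tangent_vec A \<alpha> p (c *s u) = (\<lambda>\<beta>. c *s tangent_vec A \<alpha> p u \<beta>)"
  using local_deriv_smult[OF holomorphic_map_id[OF X] \<alpha>(1) _ \<alpha>(2)]
  by (auto simp: tangent_vec_def fun_eq_iff)

lemma tangent_vec_nonzero: "u \<noteq> 0 \<Longrightarrow> tangent_vec A \<alpha> p u \<noteq> (\<lambda>\<beta>. 0)"
  using tangent_vec_self[of u] by auto

context
  fixes g :: "('a, 'n) metric"
  assumes g: "hermitian_metric X A g"
begin

lemma metric_tangent_vec_sum_left:
  assumes w: "w \<in> tangent_space A p" and "finite K"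
  shows "g p (tangent_vec A \<alpha> p (\<Sum>k\<in>K. c k *s e k)) w = (\<Sum>k\<in>K. c k * g p (tangent_vec A \<alpha> p (e k)) w)"
proof -
  have p: "p \<in> topspace X" using openin_subset[OF chart_open[OF X \<alpha>(1)]] \<alpha>(2) by blast
  have add: "g p (tangent_vec A \<alpha> p (u + u')) w = g p (tangent_vec A \<alpha> p u) w + g p (tangent_vec A \<alpha> p u') w"
    and smult: "g p (tangent_vec A \<alpha> p (a *s u)) w = a * g p (tangent_vec A \<alpha> p u) w" for a u u'
    using g p w tangent_vec_in_tangent_space unfolding hermitian_metric_def tangent_vec_add tangent_vec_smult
    by blast+
  have zero: "g p (tangent_vec A \<alpha> p 0) w = 0" using smult[of 0 0] by simp
  show ?thesis using \<open>finite K\<close> by (induction K rule: finite_induct) (simp_all add: zero add smult)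
qed

text \<open>The metric is determined by its coefficients by sesquilinearity. Its value on the left does not depend
on the chart, which is how norms computed in different charts are compared.\<close>

lemma metric_tangent_vec:
  "g p (tangent_vec A \<alpha> p u) (tangent_vec A \<alpha> p v) = herm_form (metric_coeff A g \<alpha>) (snd \<alpha> p) u v"
proof -
  have p: "p \<in> topspace X" using openin_subset[OF chart_open[OF X \<alpha>(1)]] \<alpha>(2) by blast
  let ?t = "tangent_vec A \<alpha> p"
  have sym: "g p (?t b) (?t a) = cnj (g p (?t a) (?t b))" for a b
    using g p tangent_vec_in_tangent_space unfolding hermitian_metric_def by blast
  have exp: "u = (\<Sum>k\<in>UNIV. u $ k *s axis k 1)" for u :: "complex^'n"
    by (simp add: vec_eq_iff axis_def if_distrib cong: if_cong)
  have "g p (?t u) (?t v) = (\<Sum>k\<in>UNIV. u $ k * g p (?t (axis k 1)) (?t v))"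
    by (subst exp[of u], rule metric_tangent_vec_sum_left) (auto intro: tangent_vec_in_tangent_space)
  also have "\<dots> = (\<Sum>k\<in>UNIV. u $ k * (\<Sum>l\<in>UNIV. cnj (v $ l) * g p (?t (axis k 1)) (?t (axis l 1))))"
  proof (rule sum.cong[OF refl])
    fix k
    have "g p (?t v) (?t (axis k 1)) = (\<Sum>l\<in>UNIV. v $ l * g p (?t (axis l 1)) (?t (axis k 1)))"
      by (subst exp[of v], rule metric_tangent_vec_sum_left) (auto intro: tangent_vec_in_tangent_space)
    then have "g p (?t (axis k 1)) (?t v) = cnj (\<Sum>l\<in>UNIV. v $ l * g p (?t (axis l 1)) (?t (axis k 1)))"
      using sym by metis
    then show "u $ k * g p (?t (axis k 1)) (?t v)
      = u $ k * (\<Sum>l\<in>UNIV. cnj (v $ l) * g p (?t (axis k 1)) (?t (axis l 1)))"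
      by (simp add: sym[of "axis _ 1" "axis k 1"])
  qed
  also have "\<dots> = herm_form (metric_coeff A g \<alpha>) (snd \<alpha> p) u v"
    unfolding herm_form_def metric_coeff_def Let_def chart_inv_chart[OF X \<alpha>] coord_vec_eq_tangent_vec
    by (simp add: sum_distrib_left mult_ac)
  finally show ?thesis .
qed

lemma metric_tangent_vec_pos: "u \<noteq> 0 \<Longrightarrow> Re (g p (tangent_vec A \<alpha> p u) (tangent_vec A \<alpha> p u)) > 0"
proof -
  have p: "p \<in> topspace X" using openin_subset[OF chart_open[OF X \<alpha>(1)]] \<alpha>(2) by blast
  assume "u \<noteq> 0"
  then show ?thesis using g p tangent_vec_in_tangent_space tangent_vec_nonzero unfolding hermitian_metric_def by blast
qed

end
end

lemma hermitian_coeffs_metric_coeff: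
  assumes "hermitian_manifold X A g" "\<alpha> \<in> A"
  shows "hermitian_coeffs (metric_coeff A g \<alpha>) (snd \<alpha> ` fst \<alpha>)"
proof -
  have X: "complex_manifold X A" and g: "hermitian_metric X A g"
    using assms unfolding hermitian_manifold_def by auto
  show ?thesis unfolding hermitian_coeffs_def
  proof (intro conjI allI ballI impI)
    show "open (snd \<alpha> ` fst \<alpha>)" using chart_image_open[OF X assms(2)] .
    show "wirtinger_C2 (snd \<alpha> ` fst \<alpha>) (metric_coeff A g \<alpha> k l)" for k l
      using g assms(2) unfolding hermitian_metric_def by (blast intro: smooth_on_imp_wirtinger_C2)
    fix z assume "z \<in> snd \<alpha> ` fst \<alpha>"
    then obtain p where p: "p \<in> fst \<alpha>" "z = snd \<alpha> p" by blast
    then have "p \<in> topspace X" using openin_subset[OF chart_open[OF X assms(2)]] by blast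
    then show "metric_coeff A g \<alpha> k l z = cnj (metric_coeff A g \<alpha> l k z)" for k l
      using g tangent_vec_in_tangent_space[OF X assms(2) p(1)]
      unfolding metric_coeff_def Let_def p(2) chart_inv_chart[OF X assms(2) p(1)] coord_vec_eq_tangent_vec hermitian_metric_def
      by blast
    show "Re (herm_form (metric_coeff A g \<alpha>) z a a) > 0" if "a \<noteq> 0" for a
      using metric_tangent_vec_pos[OF X assms(2) p(1) g that] metric_tangent_vec[OF X assms(2) p(1) g] p(2) by simp
  qed
qed

section \<open>The maximal stretch of a holomorphic map\<close>

abbreviation norm_sq :: "('n::finite \<Rightarrow> 'n \<Rightarrow> complex^'n \<Rightarrow> complex) \<Rightarrow> complex^'n \<Rightarrow> complex^'n \<Rightarrow> real"
  where "norm_sq G z u \<equiv> Re (herm_form G z u u)"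

text \<open>Since both squared norms are homogeneous of the same degree, the stretch defined below is a function on
the projectivised tangent bundle and can be maximised over unit vectors.\<close>

lemma norm_sq_smult: "norm_sq G z (c *s u) = (cmod c)\<^sup>2 * norm_sq G z u"
proof -
  have "herm_form G z (c *s u) (c *s u) = (c * cnj c) * herm_form G z u u"
    by (simp add: herm_form_def sum_distrib_left mult_ac)
  then show ?thesis by (simp add: complex_mult_cnj cmod_power2)
qed

lemma continuous_on_norm_sq:
  assumes G: "hermitian_coeffs G S" and a: "continuous_on K a" "a ` K \<subseteq> S" and b: "continuous_on K b"
  shows "continuous_on K (\<lambda>x. norm_sq G (a x) (b x))"
proof -
  have "continuous_on S (G k l)" for k l
    using G unfolding hermitian_coeffs_def wirtinger_C2_def
    by (meson continuous_at_imp_continuous_on differentiable_imp_continuous_within)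
  then have "continuous_on K (\<lambda>x. G k l (a x))" for k l
    using a continuous_on_compose2 by blast
  then show ?thesis unfolding herm_form_def by (intro continuous_intros b)
qed

context
  fixes M :: "'a topology" and A :: "('a, 'm::finite) chart set" and h :: "('a, 'm) metric"
    and N :: "'b topology" and B :: "('b, 'n::finite) chart set" and g :: "('b, 'n) metric"
    and f :: "'a \<Rightarrow> 'b"
  assumes M: "hermitian_manifold M A h" and N: "hermitian_manifold N B g"
    and f: "holomorphic_map M A N B f"
begin

text \<open>The ratio \<open>\<bar>f\<^sub>* u\<bar>\<^sup>2 / \<bar>u\<bar>\<^sup>2\<close>, in coordinates.\<close>

definition stretch :: "('a, 'm) chart \<Rightarrow> ('b, 'n) chart \<Rightarrow> 'a \<Rightarrow> complex^'m \<Rightarrow> real"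
  where "stretch \<alpha> \<beta> p u =
    norm_sq (metric_coeff B g \<beta>) (snd \<beta> (f p)) (local_deriv \<alpha> \<beta> f p u) / norm_sq (metric_coeff A h \<alpha>) (snd \<alpha> p) u"

lemma manifolds: "complex_manifold M A" "hermitian_metric M A h" "complex_manifold N B" "hermitian_metric N B g"
  using M N unfolding hermitian_manifold_def by auto

lemma charts_at:
  assumes "p \<in> topspace M"
  obtains \<alpha> \<beta> where "\<alpha> \<in> A" "\<beta> \<in> B" "p \<in> fst \<alpha>" "f p \<in> fst \<beta>"
proof -
  have "f p \<in> topspace N" using f assms unfolding holomorphic_map_def continuous_map_def by blast
  then show ?thesis using charts_cover[OF manifolds(1) assms] charts_cover[OF manifolds(3)] that by blast
qed

lemma norm_sq_pos:
  assumes "\<alpha> \<in> A" "p \<in> fst \<alpha>" "u \<noteq> 0"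
  shows "norm_sq (metric_coeff A h \<alpha>) (snd \<alpha> p) u > 0"
  using metric_tangent_vec_pos[OF manifolds(1) assms(1,2) manifolds(2) assms(3)]
    metric_tangent_vec[OF manifolds(1) assms(1,2) manifolds(2)] by simp

text \<open>Numerator and denominator are squared norms of tangent vectors, and neither the vector with coordinates
\<open>u\<close> nor its image under the differential of \<open>f\<close> depends on the charts.\<close>

lemma stretch_change_charts:
  assumes \<alpha>: "\<alpha> \<in> A" "p \<in> fst \<alpha>" and \<beta>: "\<beta> \<in> B" "f p \<in> fst \<beta>"
    and \<alpha>': "\<alpha>' \<in> A" "p \<in> fst \<alpha>'" and \<beta>': "\<beta>' \<in> B" "f p \<in> fst \<beta>'"
  shows "stretch \<alpha>' \<beta>' p (local_deriv \<alpha> \<alpha>' id p u) = stretch \<alpha> \<beta> p u"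
proof -
  let ?u = "local_deriv \<alpha> \<alpha>' id p u"
  have 1: "norm_sq (metric_coeff A h \<alpha>') (snd \<alpha>' p) ?u = norm_sq (metric_coeff A h \<alpha>) (snd \<alpha> p) u"
    using tangent_vec_change_chart[OF manifolds(1) \<alpha> \<alpha>', of u]
    by (metis metric_tangent_vec[OF manifolds(1) \<alpha> manifolds(2)] metric_tangent_vec[OF manifolds(1) \<alpha>' manifolds(2)])
  have "local_deriv \<alpha>' \<beta>' f p ?u = local_deriv \<beta> \<beta>' id (f p) (local_deriv \<alpha> \<beta> f p u)"
    using local_deriv_comp[OF manifolds(1) manifolds(1) holomorphic_map_id[OF manifolds(1)] f, of \<alpha> \<alpha>' \<beta>' p u]
      local_deriv_comp[OF manifolds(1) manifolds(3) f holomorphic_map_id[OF manifolds(3)], of \<alpha> \<beta> \<beta>' p u] \<alpha> \<alpha>' \<beta> \<beta>' by simp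
  then have "tangent_vec B \<beta>' (f p) (local_deriv \<alpha>' \<beta>' f p ?u) = tangent_vec B \<beta> (f p) (local_deriv \<alpha> \<beta> f p u)"
    using tangent_vec_change_chart[OF manifolds(3) \<beta> \<beta>'] by simp
  then have 2: "norm_sq (metric_coeff B g \<beta>') (snd \<beta>' (f p)) (local_deriv \<alpha>' \<beta>' f p ?u)
    = norm_sq (metric_coeff B g \<beta>) (snd \<beta> (f p)) (local_deriv \<alpha> \<beta> f p u)"
    by (metis metric_tangent_vec[OF manifolds(3) \<beta> manifolds(4)] metric_tangent_vec[OF manifolds(3) \<beta>' manifolds(4)])
  show ?thesis unfolding stretch_def 1 2 ..
qed

definition stretches :: "'a \<Rightarrow> real set"
  where "stretches p = {stretch \<alpha> \<beta> p u | \<alpha> \<beta> u. \<alpha> \<in> A \<and> \<beta> \<in> B \<and> p \<in> fst \<alpha> \<and> f p \<in> fst \<beta> \<and> u \<noteq> 0}"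

lemma stretches_in_charts:
  assumes "\<alpha> \<in> A" "p \<in> fst \<alpha>" "\<beta> \<in> B" "f p \<in> fst \<beta>"
  shows "stretches p = {stretch \<alpha> \<beta> p u | u. u \<noteq> 0}"
proof
  show "{stretch \<alpha> \<beta> p u | u. u \<noteq> 0} \<subseteq> stretches p" using assms unfolding stretches_def by blast
  show "stretches p \<subseteq> {stretch \<alpha> \<beta> p u | u. u \<noteq> 0}"
  proof
    fix r assume "r \<in> stretches p"
    then obtain \<alpha>' \<beta>' u where u: "r = stretch \<alpha>' \<beta>' p u" "\<alpha>' \<in> A" "\<beta>' \<in> B" "p \<in> fst \<alpha>'" "f p \<in> fst \<beta>'" "u \<noteq> 0"
      unfolding stretches_def by blast
    have "local_deriv \<alpha> \<alpha>' id p (local_deriv \<alpha>' \<alpha> id p u) = u"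
      using local_deriv_transition[OF manifolds(1) u(2,4), of \<alpha> \<alpha>' u] local_deriv_id[OF manifolds(1) u(2,4)] assms u by simp
    moreover have "local_deriv \<alpha> \<alpha>' id p 0 = 0"
      using local_deriv_smult[OF holomorphic_map_id[OF manifolds(1)] assms(1) u(2), of p 0 0] assms u by simp
    ultimately have "local_deriv \<alpha>' \<alpha> id p u \<noteq> 0" using u(6) by metis
    then show "r \<in> {stretch \<alpha> \<beta> p u | u. u \<noteq> 0}"
      using stretch_change_charts[OF u(2,4) u(3,5) assms, of u] u(1) by force
  qed
qed

lemma stretch_smult:
  assumes "\<alpha> \<in> A" "p \<in> fst \<alpha>" "\<beta> \<in> B" "f p \<in> fst \<beta>" "c \<noteq> 0"
  shows "stretch \<alpha> \<beta> p (c *s u) = stretch \<alpha> \<beta> p u"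
  using assms by (simp add: stretch_def norm_sq_smult local_deriv_smult[OF f])

text \<open>In a chart a compact neighbourhood of \<open>p\<close> times the unit sphere is compact, and the stretch is
continuous there. The point \<open>q\<close> at which it is maximal may lie on the boundary of the neighbourhood,
hence outside of \<open>W\<close>.\<close>

lemma stretch_locally_attains_sup:
  assumes p: "p \<in> topspace M"
  shows "\<exists>W. openin M W \<and> p \<in> W \<and> (\<exists>q\<in>topspace M. \<exists>r\<in>stretches q. \<forall>q'\<in>W. \<forall>r'\<in>stretches q'. r' \<le> r)"
proof -
  obtain \<alpha> \<beta> where charts: "\<alpha> \<in> A" "\<beta> \<in> B" "p \<in> fst \<alpha>" "f p \<in> fst \<beta>" using charts_at[OF p] .
  let ?U = "rep_dom \<alpha> \<beta> f" and ?F = "local_rep \<alpha> \<beta> f"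
  have U: "open ?U" using open_rep_dom[OF manifolds(1,3) f charts(1,2)] .
  have F: "holo_on ?F ?U" using holo_on_local_rep[OF f charts(1,2)] .
  obtain \<epsilon> where \<epsilon>: "\<epsilon> > 0" "cball (snd \<alpha> p) \<epsilon> \<subseteq> ?U"
    using U rep_domI[of p \<alpha> f \<beta>, OF charts(3,4)] open_contains_cball by blast
  let ?K = "cball (snd \<alpha> p) \<epsilon> \<times> (sphere 0 1 :: (complex^'m) set)"
  let ?r = "\<lambda>x. norm_sq (metric_coeff B g \<beta>) (?F (fst x)) (frechet_derivative ?F (at (fst x)) (snd x))
    / norm_sq (metric_coeff A h \<alpha>) (fst x) (snd x)"
  have r: "?r (snd \<alpha> q, u) = stretch \<alpha> \<beta> q u" if "q \<in> fst \<alpha>" for q u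
    using that by (simp add: stretch_def local_rep_chart[OF manifolds(1) charts(1)] local_deriv_def)
  have in_U: "\<exists>q. q \<in> fst \<alpha> \<and> f q \<in> fst \<beta> \<and> z = snd \<alpha> q" if "z \<in> ?U" for z
    using that unfolding rep_dom_def by blast
  have "continuous_on ?K ?r"
  proof (intro continuous_on_divide ballI)
    have K: "fst ` ?K \<subseteq> ?U" using \<epsilon>(2) by auto
    have "continuous_on (?U \<times> UNIV) (\<lambda>(z, v). frechet_derivative ?F (at z) v)"
      by (rule continuous_on_holo_derivative[OF F U])
    then have dF: "continuous_on ?K (\<lambda>x. frechet_derivative ?F (at (fst x)) (snd x))"
      unfolding case_prod_unfold by (rule continuous_on_subset) (use \<epsilon>(2) in auto)
    have cF: "continuous_on ?K (\<lambda>x. ?F (fst x))"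
      using holo_on_imp_continuous_on[OF F] continuous_on_fst[OF continuous_on_id] K
      by (rule continuous_on_compose2)
    show "continuous_on ?K (\<lambda>x. norm_sq (metric_coeff B g \<beta>) (?F (fst x)) (frechet_derivative ?F (at (fst x)) (snd x)))"
    proof (rule continuous_on_norm_sq[OF hermitian_coeffs_metric_coeff[OF N charts(2)] cF _ dF])
      show "(\<lambda>x. ?F (fst x)) ` ?K \<subseteq> snd \<beta> ` fst \<beta>"
      proof (rule image_subsetI)
        fix x assume "x \<in> ?K"
        then have "fst x \<in> ?U" using K by blast
        then obtain q where "q \<in> fst \<alpha>" "f q \<in> fst \<beta>" "fst x = snd \<alpha> q" using in_U by blast
        then show "?F (fst x) \<in> snd \<beta> ` fst \<beta>" by (simp add: local_rep_chart[OF manifolds(1) charts(1)])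
      qed
    qed
    show "continuous_on ?K (\<lambda>x. norm_sq (metric_coeff A h \<alpha>) (fst x) (snd x))"
    proof (rule continuous_on_norm_sq[OF hermitian_coeffs_metric_coeff[OF M charts(1)]])
      have "?U \<subseteq> snd \<alpha> ` fst \<alpha>" unfolding rep_dom_def by blast
      with K show "fst ` ?K \<subseteq> snd \<alpha> ` fst \<alpha>" by (rule order_trans)
    qed (intro continuous_intros)+
    fix x assume x: "x \<in> ?K"
    then have "fst x \<in> ?U" using K by blast
    then obtain q where q: "q \<in> fst \<alpha>" "fst x = snd \<alpha> q" using in_U by blast
    have "snd x \<noteq> 0" using x by auto
    then show "norm_sq (metric_coeff A h \<alpha>) (fst x) (snd x) \<noteq> 0"
      using norm_sq_pos[OF charts(1) q(1), of "snd x"] q(2) by simp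
  qed
  moreover have "compact ?K" by (intro compact_Times compact_cball compact_sphere)
  moreover obtain e :: "complex^'m" where "norm e = 1" using vector_choose_size[of 1] by auto
  then have "(snd \<alpha> p, e) \<in> ?K" using \<epsilon>(1) by simp
  ultimately obtain x where x: "x \<in> ?K" "\<And>y. y \<in> ?K \<Longrightarrow> ?r y \<le> ?r x"
    using continuous_attains_sup[of ?K ?r] by blast
  obtain q where q: "q \<in> fst \<alpha>" "f q \<in> fst \<beta>" "fst x = snd \<alpha> q" using x(1) \<epsilon>(2) in_U by force
  have qM: "q \<in> topspace M" using openin_subset[OF chart_open[OF manifolds(1) charts(1)]] q(1) by blast
  have "snd x \<noteq> 0" using x(1) by auto
  then have rx: "?r x \<in> stretches q"
    using r[OF q(1), of "snd x"] stretches_in_charts[OF charts(1) q(1) charts(2) q(2)] q(3)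
    by (metis (mono_tags, lifting) mem_Collect_eq prod.collapse)
  let ?W = "{q \<in> fst \<alpha>. snd \<alpha> q \<in> ball (snd \<alpha> p) \<epsilon>}"
  have le: "r' \<le> ?r x" if q': "q' \<in> ?W" and r': "r' \<in> stretches q'" for q' r'
  proof -
    have q'1: "q' \<in> fst \<alpha>" "snd \<alpha> q' \<in> cball (snd \<alpha> p) \<epsilon>" using q' by auto
    obtain q'' where q'': "q'' \<in> fst \<alpha>" "f q'' \<in> fst \<beta>" "snd \<alpha> q' = snd \<alpha> q''"
      using in_U q'1(2) \<epsilon>(2) by blast
    have "q'' = q'" using inj_onD[OF chart_inj[OF manifolds(1) charts(1)] q''(3) q'1(1) q''(1)] by simp
    then have q'2: "f q' \<in> fst \<beta>" using q''(2) by simp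
    obtain u where u: "u \<noteq> 0" "r' = stretch \<alpha> \<beta> q' u"
      using r' stretches_in_charts[OF charts(1) q'1(1) charts(2) q'2] by blast
    let ?u = "complex_of_real (1 / norm u) *s u"
    have "r' = stretch \<alpha> \<beta> q' ?u"
      using u stretch_smult[OF charts(1) q'1(1) charts(2) q'2, of "complex_of_real (1 / norm u)" u] by simp
    also have "\<dots> = ?r (snd \<alpha> q', ?u)" by (rule r[OF q'1(1), symmetric])
    also have "\<dots> \<le> ?r x" using q'1(2) u(1) by (intro x(2)) (simp add: norm_smult_vec norm_divide)
    finally show ?thesis .
  qed
  have "openin M ?W" by (rule openin_chart_preimage[OF manifolds(1) charts(1) open_ball])
  moreover have "p \<in> ?W" using charts(3) \<epsilon>(1) by simp
  ultimately show ?thesis using qM rx le by blast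
qed

text \<open>Finitely many of the neighbourhoods with a local bound cover the compact manifold, and the largest of
the finitely many bounds is a global one. It is a value of the stretch because each bound is.\<close>

lemma stretch_attains_sup:
  assumes "compact_space M" "topspace M \<noteq> {}"
  shows "\<exists>q\<in>topspace M. \<exists>C\<in>stretches q. \<forall>q'\<in>topspace M. \<forall>r\<in>stretches q'. r \<le> C"
proof -
  define P where "P W q r \<longleftrightarrow> q \<in> topspace M \<and> r \<in> stretches q \<and> (\<forall>q'\<in>W. \<forall>r'\<in>stretches q'. r' \<le> r)"
    for W q r
  define \<U> where "\<U> = {W. openin M W \<and> (\<exists>q r. P W q r)}"
  have "p \<in> \<Union>\<U>" if p: "p \<in> topspace M" for p
  proof -
    obtain W q r where "openin M W" "p \<in> W" "P W q r"
      using stretch_locally_attains_sup[OF p] unfolding P_def by blast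
    then have "W \<in> \<U>" unfolding \<U>_def by blast
    then show ?thesis using \<open>p \<in> W\<close> by (rule UnionI)
  qed
  then have "topspace M \<subseteq> \<Union>\<U>" by (rule subsetI)
  moreover have "\<forall>W\<in>\<U>. openin M W" by (simp add: \<U>_def)
  ultimately obtain \<F> where \<F>: "finite \<F>" "\<F> \<subseteq> \<U>" "topspace M \<subseteq> \<Union>\<F>"
    using assms(1) unfolding compact_space_def compactin_def by metis
  from \<F>(2) have "\<forall>W\<in>\<F>. \<exists>r q. P W q r" unfolding \<U>_def by blast
  then obtain R where R: "\<And>W. W \<in> \<F> \<Longrightarrow> \<exists>q. P W q (R W)" by metis
  have "\<F> \<noteq> {}" using \<F>(3) assms(2) by auto
  then have "Max (R ` \<F>) \<in> R ` \<F>" using \<F>(1) by (intro Max_in) auto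
  then obtain W where W: "W \<in> \<F>" "R W = Max (R ` \<F>)" by auto
  have max: "R W' \<le> R W" if "W' \<in> \<F>" for W' using W(2) \<F>(1) that by simp
  obtain q where q: "P W q (R W)" using R[OF W(1)] by blast
  have "r \<le> R W" if q': "q' \<in> topspace M" and r: "r \<in> stretches q'" for q' r
  proof -
    obtain W' where W': "W' \<in> \<F>" "q' \<in> W'" using \<F>(3) q' by blast
    then have "r \<le> R W'" using R[OF W'(1)] r unfolding P_def by blast
    then show ?thesis using max[OF W'(1)] by linarith
  qed
  then show ?thesis using q unfolding P_def by blast
qed

text \<open>A nonpositive stretch forces the differential of \<open>f\<close> to vanish. Then \<open>f\<close> is locally constant, so its
fibres are open and closed in the connected manifold.\<close>

lemma constant_if_stretch_nonpos:
  assumes le: "\<And>q r. q \<in> topspace M \<Longrightarrow> r \<in> stretches q \<Longrightarrow> r \<le> 0"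
  shows "f constant_on topspace M"
proof -
  have locally: "\<exists>W. openin M W \<and> p \<in> W \<and> (\<forall>q\<in>W. f q = f p)" if p: "p \<in> topspace M" for p
  proof -
    obtain \<alpha> \<beta> where charts: "\<alpha> \<in> A" "\<beta> \<in> B" "p \<in> fst \<alpha>" "f p \<in> fst \<beta>" using charts_at[OF p] .
    let ?U = "rep_dom \<alpha> \<beta> f" and ?F = "local_rep \<alpha> \<beta> f"
    obtain \<epsilon> where \<epsilon>: "\<epsilon> > 0" "ball (snd \<alpha> p) \<epsilon> \<subseteq> ?U"
      using open_rep_dom[OF manifolds(1,3) f charts(1,2)] rep_domI[of p \<alpha> f \<beta>, OF charts(3,4)]
      unfolding open_contains_ball by blast
    have in_U: "\<exists>q. q \<in> fst \<alpha> \<and> f q \<in> fst \<beta> \<and> z = snd \<alpha> q" if "z \<in> ?U" for z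
      using that unfolding rep_dom_def by blast
    have "\<exists>c. \<forall>z\<in>ball (snd \<alpha> p) \<epsilon>. ?F z = c"
    proof (rule has_derivative_zero_constant)
      fix z assume "z \<in> ball (snd \<alpha> p) \<epsilon>"
      then obtain q where q: "q \<in> fst \<alpha>" "f q \<in> fst \<beta>" "z = snd \<alpha> q" using in_U \<epsilon>(2) by blast
      then have qM: "q \<in> topspace M" using openin_subset[OF chart_open[OF manifolds(1) charts(1)]] by blast
      have "local_deriv \<alpha> \<beta> f q u = 0" for u
      proof (cases "u = 0")
        case True
        then show ?thesis using local_deriv_smult[OF f charts(1,2) q(1,2), of 0 0] by simp
      next
        case False
        have "stretch \<alpha> \<beta> q u \<le> 0"
          using le[OF qM] False stretches_in_charts[OF charts(1) q(1) charts(2) q(2)] by blast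
        then have "\<not> norm_sq (metric_coeff B g \<beta>) (snd \<beta> (f q)) (local_deriv \<alpha> \<beta> f q u) > 0"
          using norm_sq_pos[OF charts(1) q(1) False] by (simp add: stretch_def divide_le_0_iff)
        then show ?thesis
          using metric_tangent_vec_pos[OF manifolds(3) charts(2) q(2) manifolds(4)] metric_tangent_vec[OF manifolds(3) charts(2) q(2) manifolds(4)]
          by metis
      qed
      then have "local_deriv \<alpha> \<beta> f q = (\<lambda>u. 0)" by (rule ext)
      then have "(?F has_derivative (\<lambda>u. 0)) (at z)"
        using has_derivative_local_rep[OF f charts(1,2) q(1,2)] q(3) by simp
      then show "(?F has_derivative (\<lambda>u. 0)) (at z within ball (snd \<alpha> p) \<epsilon>)" by (rule has_derivative_at_withinI)
    qed auto
    then obtain c where c: "\<And>z. z \<in> ball (snd \<alpha> p) \<epsilon> \<Longrightarrow> ?F z = c" by blast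
    let ?W = "{q \<in> fst \<alpha>. snd \<alpha> q \<in> ball (snd \<alpha> p) \<epsilon>}"
    have "f q = f p" if "q \<in> ?W" for q
    proof -
      have q: "q \<in> fst \<alpha>" "snd \<alpha> q \<in> ball (snd \<alpha> p) \<epsilon>" using that by auto
      obtain q' where q': "q' \<in> fst \<alpha>" "f q' \<in> fst \<beta>" "snd \<alpha> q = snd \<alpha> q'" using in_U q(2) \<epsilon>(2) by blast
      have "q' = q" using inj_onD[OF chart_inj[OF manifolds(1) charts(1)] q'(3) q(1) q'(1)] by simp
      then have fq: "f q \<in> fst \<beta>" using q'(2) by simp
      have "snd \<beta> (f q) = snd \<beta> (f p)"
        using c[OF q(2)] c[of "snd \<alpha> p"] \<epsilon>(1) local_rep_chart[OF manifolds(1) charts(1) q(1), of \<beta> f]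
          local_rep_chart[OF manifolds(1) charts(1,3), of \<beta> f] by simp
      then show ?thesis using inj_onD[OF chart_inj[OF manifolds(3) charts(2)] _ fq charts(4)] by simp
    qed
    moreover have "openin M ?W" by (rule openin_chart_preimage[OF manifolds(1) charts(1) open_ball])
    moreover have "p \<in> ?W" using charts(3) \<epsilon>(1) by simp
    ultimately show ?thesis by blast
  qed
  show ?thesis
  proof (cases "topspace M = {}")
    case True
    then show ?thesis by (simp add: constant_on_def)
  next
    case False
    then obtain p where p: "p \<in> topspace M" by blast
    let ?E = "{q \<in> topspace M. f q = f p}" and ?E' = "{q \<in> topspace M. f q \<noteq> f p}"
    have "openin M {q \<in> topspace M. Q (f q)}" for Q
    proof (subst openin_subopen, intro ballI)
      fix q assume q: "q \<in> {q \<in> topspace M. Q (f q)}"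
      then obtain W where W: "openin M W" "q \<in> W" "\<And>q'. q' \<in> W \<Longrightarrow> f q' = f q" using locally[of q] by auto
      have "W \<subseteq> {q \<in> topspace M. Q (f q)}" using openin_subset[OF W(1)] W(3) q by auto
      then show "\<exists>W. openin M W \<and> q \<in> W \<and> W \<subseteq> {q \<in> topspace M. Q (f q)}" using W by blast
    qed
    from this[of "\<lambda>y. y = f p"] this[of "\<lambda>y. y \<noteq> f p"] have "openin M ?E" "openin M ?E'" .
    moreover have "topspace M - ?E = ?E'" by auto
    ultimately have "openin M ?E \<and> closedin M ?E" by (simp add: closedin_def)
    moreover have "connected_space M" using manifolds(1) by (simp add: complex_manifold_def)
    ultimately have "?E = {} \<or> ?E = topspace M" unfolding connected_space_clopen_in by blast
    then have "?E = topspace M" using p by blast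
    then show ?thesis unfolding constant_on_def by blast
  qed
qed

text \<open>A maximum of the stretch on the whole tangent bundle is in particular one in the coordinates around it,
so the local comparison applies. The image vector is nonzero because the maximal stretch \<open>C\<close> is
positive.\<close>

lemma curvature_comparison_at_max_stretch:
  assumes q: "q \<in> topspace M" and C: "C \<in> stretches q" "C > 0"
    and max: "\<forall>q'\<in>topspace M. \<forall>r\<in>stretches q'. r \<le> C"
  obtains \<alpha> \<beta> v w where "\<alpha> \<in> A" "q \<in> fst \<alpha>" "v \<in> tangent_space A q" "v \<noteq> (\<lambda>_. 0)"
    "\<beta> \<in> B" "f q \<in> fst \<beta>" "w \<in> tangent_space B (f q)" "w \<noteq> (\<lambda>_. 0)"
    "C * curv_form A h \<alpha> q v \<le> curv_form B g \<beta> (f q) w"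
proof -
  obtain \<alpha> \<beta> where charts: "\<alpha> \<in> A" "\<beta> \<in> B" "q \<in> fst \<alpha>" "f q \<in> fst \<beta>" using charts_at[OF q] .
  obtain u where u: "u \<noteq> 0" "C = stretch \<alpha> \<beta> q u"
    using C(1) stretches_in_charts[OF charts(1,3,2,4)] by blast
  let ?U = "rep_dom \<alpha> \<beta> f" and ?F = "local_rep \<alpha> \<beta> f" and ?w = "local_deriv \<alpha> \<beta> f q u"
  have F: "holo_on ?F ?U" using holo_on_local_rep[OF f charts(1,2)] .
  have Fq: "?F (snd \<alpha> q) = snd \<beta> (f q)" by (rule local_rep_chart[OF manifolds(1) charts(1,3)])
  have eq: "norm_sq (metric_coeff B g \<beta>) (snd \<beta> (f q)) ?w = C * norm_sq (metric_coeff A h \<alpha>) (snd \<alpha> q) u"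
    using u norm_sq_pos[OF charts(1,3) u(1)] by (simp add: stretch_def)
  have w: "?w \<noteq> 0"
  proof
    assume "?w = 0"
    then have "C * norm_sq (metric_coeff A h \<alpha>) (snd \<alpha> q) u = 0" using eq by (simp add: herm_form_def)
    then show False using C(2) norm_sq_pos[OF charts(1,3) u(1)] by simp
  qed
  have "C * coeff_curv (metric_coeff A h \<alpha>) (snd \<alpha> q) u
    \<le> coeff_curv (metric_coeff B g \<beta>) (?F (snd \<alpha> q)) (frechet_derivative ?F (at (snd \<alpha> q)) u)"
  proof (rule curvature_comparison_at_max[OF hermitian_coeffs_metric_coeff[OF M charts(1)]
        hermitian_coeffs_metric_coeff[OF N charts(2)]])
    show "open ?U" using open_rep_dom[OF manifolds(1,3) f charts(1,2)] .
    show "?U \<subseteq> snd \<alpha> ` fst \<alpha>" unfolding rep_dom_def by blast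
    show "snd \<alpha> q \<in> ?U" using charts(3,4) by (rule rep_domI)
    show "holo_on ?F ?U" by (rule F)
    show "?F ` ?U \<subseteq> snd \<beta> ` fst \<beta>"
      using local_rep_chart[OF manifolds(1) charts(1), of _ \<beta> f] by (auto simp: rep_dom_def)
    show "norm_sq (metric_coeff B g \<beta>) (?F (snd \<alpha> q)) (frechet_derivative ?F (at (snd \<alpha> q)) u)
      = C * norm_sq (metric_coeff A h \<alpha>) (snd \<alpha> q) u"
      using eq Fq by (simp add: local_deriv_def)
    fix x a assume "x \<in> ?U"
    then obtain p where p: "p \<in> fst \<alpha>" "f p \<in> fst \<beta>" "x = snd \<alpha> p" unfolding rep_dom_def by blast
    then have pM: "p \<in> topspace M" using openin_subset[OF chart_open[OF manifolds(1) charts(1)]] by blast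
    have "norm_sq (metric_coeff B g \<beta>) (snd \<beta> (f p)) (local_deriv \<alpha> \<beta> f p a) \<le> C * norm_sq (metric_coeff A h \<alpha>) (snd \<alpha> p) a"
    proof (cases "a = 0")
      case True
      then show ?thesis using local_deriv_smult[OF f charts(1,2) p(1,2), of 0 0] by (simp add: herm_form_def)
    next
      case False
      then have "stretch \<alpha> \<beta> p a \<le> C"
        using bspec[OF max pM] stretches_in_charts[OF charts(1) p(1) charts(2) p(2)] by blast
      then show ?thesis
        using norm_sq_pos[OF charts(1) p(1) False] by (simp add: stretch_def pos_divide_le_eq)
    qed
    then show "norm_sq (metric_coeff B g \<beta>) (?F x) (frechet_derivative ?F (at x) a) \<le> C * norm_sq (metric_coeff A h \<alpha>) x a"
      unfolding p(3) local_rep_chart[OF manifolds(1) charts(1) p(1)] local_deriv_def .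
  qed
  then have "C * curv_form A h \<alpha> q (tangent_vec A \<alpha> q u) \<le> curv_form B g \<beta> (f q) (tangent_vec B \<beta> (f q) ?w)"
    unfolding curv_form_eq_coeff_curv tangent_vec_self[OF manifolds(1) charts(1,3)] tangent_vec_self[OF manifolds(3) charts(2,4)]
    using Fq by (simp add: local_deriv_def)
  then show ?thesis
    using that charts tangent_vec_in_tangent_space[OF manifolds(1) charts(1,3)] tangent_vec_nonzero[OF manifolds(1) charts(1,3) u(1)]
      tangent_vec_in_tangent_space[OF manifolds(3) charts(2,4)] tangent_vec_nonzero[OF manifolds(3) charts(2,4) w] by blast
qed

end

theorem theorem1p2:
  fixes M :: "'a topology" and A :: "('a, 'm::finite) chart set" and h :: "('a, 'm) metric"
    and N :: "'b topology" and B :: "('b, 'n::finite) chart set" and g :: "('b, 'n) metric"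
    and f :: "'a \<Rightarrow> 'b"
  assumes "hermitian_manifold M A h"
    and "hermitian_manifold N B g"
    and "compact_space M"
    and "holomorphic_map M A N B f"
    and "(hsc_positive M A h \<and> hsc_nonpositive N B g) \<or>
         (hsc_nonnegative M A h \<and> hsc_negative N B g)"
  shows "f constant_on topspace M"
proof (rule ccontr)
  assume not_const: "\<not> f constant_on topspace M"
  note mfd = assms(1,2,4)
  let ?S = "stretches A h B g f"
  have "topspace M \<noteq> {}" using not_const by (auto simp: constant_on_def)
  then obtain q C where q: "q \<in> topspace M" and C: "C \<in> ?S q"
    and max: "\<forall>q'\<in>topspace M. \<forall>r\<in>?S q'. r \<le> C"
    using stretch_attains_sup[OF mfd assms(3)] by blast
  have "C > 0"
  proof (rule ccontr)
    assume "\<not> C > 0"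
    then show False using constant_if_stretch_nonpos[OF mfd] max not_const by fastforce
  qed
  obtain \<alpha> \<beta> v w where v: "\<alpha> \<in> A" "q \<in> fst \<alpha>" "v \<in> tangent_space A q" "v \<noteq> (\<lambda>_. 0)"
    and w: "\<beta> \<in> B" "f q \<in> fst \<beta>" "w \<in> tangent_space B (f q)" "w \<noteq> (\<lambda>_. 0)"
    and le: "C * curv_form A h \<alpha> q v \<le> curv_form B g \<beta> (f q) w"
    by (rule curvature_comparison_at_max_stretch[OF mfd q C \<open>C > 0\<close> max], rule that)
  have fq: "f q \<in> topspace N"
    using assms(4) q unfolding holomorphic_map_def continuous_map_def by blast
  from assms(5) show False
  proof
    assume "hsc_positive M A h \<and> hsc_nonpositive N B g"
    then have "curv_form A h \<alpha> q v > 0" "curv_form B g \<beta> (f q) w \<le> 0"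
      using q v fq w unfolding hsc_satisfies_def by blast+
    then show False using le \<open>C > 0\<close> by (smt (verit) mult_pos_pos)
  next
    assume "hsc_nonnegative M A h \<and> hsc_negative N B g"
    then have "curv_form A h \<alpha> q v \<ge> 0" "curv_form B g \<beta> (f q) w < 0"
      using q v fq w unfolding hsc_satisfies_def by blast+
    then show False using le \<open>C > 0\<close> by (smt (verit) mult_nonneg_nonneg)
  qed
qed

end
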